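(* Let $W$ be an irreducible finite real reflection group with complexified reflection representation $\mathfrak h$, $n=\dim\mathfrak h$, let $t\in\mathbb C$ and let $c:\mathcal S\to\mathbb C$ be a conjugation-invariant function. Then, as subalgebras of the rational Cherednik algebra $H_{t,c}=H_{t,c}(W)$, one has $H_{t,c}^{\mathfrak{so}(n)}=H_{t,c}^{\mathrm{SL}_2}$.
   Context: $W$ acts on a real Euclidean space by orthogonal transformations and is generated by reflections; $\mathfrak h$ is the complexification of this space, with complex-bilinear $W$-invariant form $(\cdot,\cdot)$ extending the inner product. $\mathcal S$ is the set of reflections in $W$; for $s\in\mathcal S$ choose $\alpha_s\in\mathfrak h^*$, $\alpha_s^\vee\in\mathfrak h$ with $s(v)=v-\alpha_s(v)\alpha_s^\vee$ for all $v\in\mathfrak h$ (so $\alpha_s(\alpha_s^\vee)=2$). The rational Cherednik algebra $H_{t,c}$ is the quotient of $T(\mathfrak h\oplus\mathfrak h^* )\rtimes W$ by the relations $[x,x']=0$, $[y,y']=0$, $[y,x]=t\,x(y)-\sum_{s\in\mathcal S}\frac{2c_s}{\alpha_s(\alpha_s^\vee)}x(\alpha_s^\vee)\alpha_s(y)\,s$ for $x,x'\in\mathfrak h^*$, $y,y'\in\mathfrak h$. Let $y_1,\dots,y_n$ be an orthonormal basis of $\mathfrak h$ (taken in the real Euclidean space) and $x_1,\dots,x_n$ the dual basis of $\mathfrak h^*$. The Dunkl angular momentum subalgebra $H_{t,c}^{\mathfrak{so}(n)}$ is the subalgebra of $H_{t,c}$ generated by all $M_{ij}=x_iy_j-x_jy_i$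 ($1\le i,j\le n$) and $W$. For $v\in\mathfrak h$ let $v^*=(v,\cdot)\in\mathfrak h^*$. Each $g=\begin{pmatrix}a&b\\c&d\end{pmatrix}\in\mathrm{SL}_2(\mathbb C)$ defines an algebra automorphism of $H_{t,c}$ fixing $W$ pointwise and given by $v\mapsto av+bv^*$, $v^*\mapsto cv+dv^*$. $H_{t,c}^{\mathrm{SL}_2}$ is the subalgebra of elements fixed by all these automorphisms. *)

theory Defs
  imports "HOL-Analysis.Analysis" "HOL-Library.Poly_Mapping"
    "HOL-Algebra.QuotRing" "HOL-Algebra.Generated_Rings" "HOL-Algebra.Generated_Groups"
begin

section \<open>Real reflection groups and complexification\<close>

definition orth_group :: "(real^'n \<Rightarrow> real^'n) monoid" where
  "orth_group = \<lparr>carrier = {f. orthogonal_transformation f}, mult = (\<circ>), one = id\<rparr>"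

definition is_reflection :: "(real^'n \<Rightarrow> real^'n) \<Rightarrow> bool" where
  "is_reflection s \<longleftrightarrow> (\<exists>a. a \<noteq> 0 \<and> (\<forall>v. s v = v - (2 * (v \<bullet> a) / (a \<bullet> a)) *\<^sub>R a))"

definition reflections_in :: "(real^'n \<Rightarrow> real^'n) set \<Rightarrow> (real^'n \<Rightarrow> real^'n) set" where
  "reflections_in W = {s \<in> W. is_reflection s}"

definition finite_reflection_group :: "(real^'n \<Rightarrow> real^'n) set \<Rightarrow> bool" where
  "finite_reflection_group W \<longleftrightarrow>
     finite W \<and> subgroup W orth_group \<and> generate orth_group (reflections_in W) = W"

definition irreducible_action :: "(real^'n \<Rightarrow> real^'n) set \<Rightarrow> bool" where
  "irreducible_action W \<longleftrightarrow>
     (\<forall>U. subspace U \<and> (\<forall>w\<in>W. w ` U \<subseteq> U) \<longrightarrow> U = {0} \<or> U = UNIV)"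

definition conj_invariant :: "(real^'n \<Rightarrow> real^'n) set \<Rightarrow> ((real^'n \<Rightarrow> real^'n) \<Rightarrow> complex) \<Rightarrow> bool" where
  "conj_invariant W c \<longleftrightarrow>
     (\<forall>s\<in>reflections_in W. \<forall>w\<in>W. c (w \<circ> s \<circ> inv_into UNIV w) = c s)"

definition cvec :: "real^'n \<Rightarrow> complex^'n" where
  "cvec v = (\<chi> i. complex_of_real (v $ i))"

definition complexify :: "(real^'n \<Rightarrow> real^'n) \<Rightarrow> complex^'n \<Rightarrow> complex^'n" where
  "complexify w v = cvec (w (\<chi> i. Re (v $ i))) + \<i> *s cvec (w (\<chi> i. Im (v $ i)))"

definition cform :: "complex^'n \<Rightarrow> complex^'n \<Rightarrow> complex" where
  "cform u v = (\<Sum>i\<in>UNIV. u $ i * v $ i)"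

abbreviation clinear_functional :: "(complex^'n \<Rightarrow> complex) \<Rightarrow> bool" where
  "clinear_functional \<equiv> Vector_Spaces.linear (*s) (*)"

text \<open>\<open>\<alpha> s\<close> and \<open>\<alpha>v s\<close> are the chosen root and coroot of the reflection \<open>s\<close>.\<close>

definition root_data :: "(real^'n \<Rightarrow> real^'n) set \<Rightarrow> ((real^'n \<Rightarrow> real^'n) \<Rightarrow> complex^'n \<Rightarrow> complex)
    \<Rightarrow> ((real^'n \<Rightarrow> real^'n) \<Rightarrow> complex^'n) \<Rightarrow> bool" where
  "root_data W \<alpha> \<alpha>v \<longleftrightarrow>
     (\<forall>s\<in>reflections_in W. clinear_functional (\<alpha> s) \<and>
        (\<forall>v. complexify s v = v - \<alpha> s v *s \<alpha>v s))"


section \<open>Free algebras\<close>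

text \<open>Words over an alphabet form a monoid under concatenation, so the convolution product of
  \<^theory>\<open>HOL-Library.Poly_Mapping\<close> makes \<open>'l list \<Rightarrow>\<^sub>0 complex\<close> the free associative algebra.\<close>

instantiation list :: (type) monoid_add
begin
definition zero_list :: "'a list" where "zero_list = []"
definition plus_list :: "'a list \<Rightarrow> 'a list \<Rightarrow> 'a list" where "plus_list = (@)"
instance by standard (simp_all add: zero_list_def plus_list_def)
end

definition free_algebra :: "'l set \<Rightarrow> ('l list \<Rightarrow>\<^sub>0 complex) ring" where
  "free_algebra L = \<lparr>carrier = {p. \<forall>u\<in>Poly_Mapping.keys p. set u \<subseteq> L},
     mult = (*), one = 1, zero = 0, add = (+)\<rparr>"

definition gen :: "'l \<Rightarrow> ('l list \<Rightarrow>\<^sub>0 complex)" where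
  "gen l = Poly_Mapping.single [l] 1"

definition const :: "complex \<Rightarrow> ('l list \<Rightarrow>\<^sub>0 complex)" where
  "const a = Poly_Mapping.single [] a"

definition commutator :: "'r::ring \<Rightarrow> 'r \<Rightarrow> 'r" where
  "commutator p q = p * q - q * p"


section \<open>The rational Cherednik algebra\<close>


datatype ('n::finite) letter =
    Vec "complex^'n"
  | Cov "complex^'n \<Rightarrow> complex"
  | Grp "real^'n \<Rightarrow> real^'n"

type_synonym 'n free = "'n letter list \<Rightarrow>\<^sub>0 complex"

definition letters :: "(real^'n \<Rightarrow> real^'n) set \<Rightarrow> 'n letter set" where
  "letters W = range Vec \<union> Cov ` {f. clinear_functional f} \<union> Grp ` W"

text \<open>The free algebra on \<open>letters W\<close> modulo these relations is \<open>T(\<hh> \<oplus> \<hh>\<^sup>*) \<rtimes> W\<close>: the first group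
  makes \<open>\<hh>\<close> and \<open>\<hh>\<^sup>*\<close> linear subspaces, the second gives the group algebra of \<open>W\<close>, the third
  is the action of \<open>W\<close> on \<open>\<hh>\<close> and the contragredient action on \<open>\<hh>\<^sup>*\<close>.\<close>

definition semidirect_relations :: "(real^'n \<Rightarrow> real^'n) set \<Rightarrow> 'n free set" where
  "semidirect_relations W =
     {gen (Vec (u + v)) - (gen (Vec u) + gen (Vec v)) | u v. True} \<union>
     {gen (Vec (a *s v)) - const a * gen (Vec v) | a v. True} \<union>
     {gen (Cov (\<lambda>v. f v + h v)) - (gen (Cov f) + gen (Cov h)) | f h.
        clinear_functional f \<and> clinear_functional h} \<union>
     {gen (Cov (\<lambda>v. a * f v)) - const a * gen (Cov f) | a f. clinear_functional f} \<union>
     {gen (Grp id) - 1} \<union>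
     {gen (Grp (w \<circ> w')) - gen (Grp w) * gen (Grp w') | w w'. w \<in> W \<and> w' \<in> W} \<union>
     {gen (Grp w) * gen (Vec v) - gen (Vec (complexify w v)) * gen (Grp w) | w v. w \<in> W} \<union>
     {gen (Grp w) * gen (Cov f)
        - gen (Cov (f \<circ> complexify (inv_into UNIV w))) * gen (Grp w) | w f.
        w \<in> W \<and> clinear_functional f}"

definition cherednik_relations :: "(real^'n \<Rightarrow> real^'n) set
    \<Rightarrow> ((real^'n \<Rightarrow> real^'n) \<Rightarrow> complex^'n \<Rightarrow> complex) \<Rightarrow> ((real^'n \<Rightarrow> real^'n) \<Rightarrow> complex^'n)
    \<Rightarrow> complex \<Rightarrow> ((real^'n \<Rightarrow> real^'n) \<Rightarrow> complex) \<Rightarrow> 'n free set" where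
  "cherednik_relations W \<alpha> \<alpha>v t c =
     {commutator (gen (Cov x)) (gen (Cov x')) | x x'.
        clinear_functional x \<and> clinear_functional x'} \<union>
     {commutator (gen (Vec y)) (gen (Vec y')) | y y'. True} \<union>
     {commutator (gen (Vec y)) (gen (Cov x))
        - (const (t * x y)
           - (\<Sum>s\<in>reflections_in W.
                const (2 * c s / \<alpha> s (\<alpha>v s) * x (\<alpha>v s) * \<alpha> s y) * gen (Grp s))) | x y.
        clinear_functional x}"

definition cherednik_ideal where
  "cherednik_ideal W \<alpha> \<alpha>v t c =
     Idl\<^bsub>free_algebra (letters W)\<^esub> (semidirect_relations W \<union> cherednik_relations W \<alpha> \<alpha>v t c)"

definition cherednik_algebra where
  "cherednik_algebra W \<alpha> \<alpha>v t c =
     free_algebra (letters W) Quot cherednik_ideal W \<alpha> \<alpha>v t c"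

text \<open>The class in \<open>H\<^sub>t\<^sub>,\<^sub>c\<close> of an element of the free algebra.\<close>

definition cherednik_class where
  "cherednik_class W \<alpha> \<alpha>v t c p =
     cherednik_ideal W \<alpha> \<alpha>v t c +>\<^bsub>free_algebra (letters W)\<^esub> p"


section \<open>The two subalgebras\<close>

text \<open>The constants are included among the generators because subalgebras are over \<open>\<complex>\<close>.\<close>

definition dunkl_angular_momentum_algebra where
  "dunkl_angular_momentum_algebra W \<alpha> \<alpha>v t c y x =
     generate_ring (cherednik_algebra W \<alpha> \<alpha>v t c)
       (range (\<lambda>a. cherednik_class W \<alpha> \<alpha>v t c (const a)) \<union>
        {cherednik_class W \<alpha> \<alpha>v t c
           (gen (Cov (x i)) * gen (Vec (cvec (y j))) - gen (Cov (x j)) * gen (Vec (cvec (y i)))) | i j. True} \<union>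
        (\<lambda>w. cherednik_class W \<alpha> \<alpha>v t c (gen (Grp w))) ` W)"

definition sl2_automorphism where
  "sl2_automorphism W \<alpha> \<alpha>v t c (g :: complex^2^2) \<phi> \<longleftrightarrow>
     (let H = cherednik_algebra W \<alpha> \<alpha>v t c; cls = cherednik_class W \<alpha> \<alpha>v t c in
      \<phi> \<in> ring_iso H H \<and>
      (\<forall>a. \<phi> (cls (const a)) = cls (const a)) \<and>
      (\<forall>w\<in>W. \<phi> (cls (gen (Grp w))) = cls (gen (Grp w))) \<and>
      (\<forall>v. \<phi> (cls (gen (Vec v)))
             = cls (const (g$1$1) * gen (Vec v) + const (g$1$2) * gen (Cov (cform v)))) \<and>
      (\<forall>v. \<phi> (cls (gen (Cov (cform v))))
             = cls (const (g$2$1) * gen (Vec v) + const (g$2$2) * gen (Cov (cform v)))))"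

definition sl2_invariants where
  "sl2_invariants W \<alpha> \<alpha>v t c =
     {h \<in> carrier (cherednik_algebra W \<alpha> \<alpha>v t c).
        \<forall>g \<phi>. det g = 1 \<and> sl2_automorphism W \<alpha> \<alpha>v t c g \<phi> \<longrightarrow> \<phi> h = h}"


section \<open>Existence of the automorphisms\<close>

text \<open>Lemma \<open>sl2_exists\<close> below: every \<open>g \<in> SL\<^sub>2(\<complex>)\<close> does induce an automorphism of \<open>H\<^sub>t\<^sub>,\<^sub>c\<close>, so that the
  quantification over \<open>\<phi>\<close> in \<^const>\<open>sl2_invariants\<close> is not vacuous.\<close>

lemma single_mult_list:
  "Poly_Mapping.single u a * Poly_Mapping.single v b = Poly_Mapping.single (u @ v) (a * (b::complex))"
  by (simp add: mult_single plus_list_def)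

lemma one_free: "(1 :: 'l list \<Rightarrow>\<^sub>0 complex) = Poly_Mapping.single [] 1"
  by (metis single_one zero_list_def)

lemma const_simps [simp]:
  "const (a + b) = const a + const b" "const (a * b) = const a * const b"
  "const 0 = 0" "const 1 = 1" "const (- a) = - const a" "const (a - b) = const a - const b"
  by (simp_all add: const_def single_add single_mult_list one_free single_uminus single_diff)

lemma free_induct [case_names zero single add]:
  fixes p :: "'l list \<Rightarrow>\<^sub>0 complex"
  assumes "P 0" "\<And>u a. P (Poly_Mapping.single u a)" "\<And>p q. P p \<Longrightarrow> P q \<Longrightarrow> P (p + q)"
  shows "P p"
proof (induction p rule: update_induct)
  case const then show ?case by (rule assms)
next
  case (update f a b)
  have "Poly_Mapping.update a b f = f + Poly_Mapping.single a b"
    using update(1) by (intro poly_mapping_eqI) (auto simp: lookup_update lookup_add lookup_single in_keys_iff when_def)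
  then show ?case using assms update by simp
qed

lemma const_commute: "const a * p = p * const a"
proof (induction p rule: free_induct)
  case zero then show ?case by simp
next
  case (single u b) then show ?case by (simp add: const_def single_mult_list mult.commute)
next
  case (add p q) then show ?case by (simp add: distrib_left distrib_right)
qed

lemma free_carrier: "p \<in> carrier (free_algebra L) \<longleftrightarrow> (\<forall>u\<in>Poly_Mapping.keys p. set u \<subseteq> L)"
  by (simp add: free_algebra_def)

lemma free_ops [simp]:
  "(\<otimes>\<^bsub>free_algebra L\<^esub>) = (*)" "(\<oplus>\<^bsub>free_algebra L\<^esub>) = (+)"
  "\<one>\<^bsub>free_algebra L\<^esub> = 1" "\<zero>\<^bsub>free_algebra L\<^esub> = 0"
  by (simp_all add: free_algebra_def)

lemma fc_add: "p \<in> carrier (free_algebra L) \<Longrightarrow> q \<in> carrier (free_algebra L) \<Longrightarrow> p + q \<in> carrier (free_algebra L)"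
  using keys_add[of p q] by (auto simp: free_carrier)
lemma fc_mult: "p \<in> carrier (free_algebra L) \<Longrightarrow> q \<in> carrier (free_algebra L) \<Longrightarrow> p * q \<in> carrier (free_algebra L)"
  using keys_mult[of p q] by (fastforce simp: free_carrier plus_list_def)
lemma fc_uminus: "p \<in> carrier (free_algebra L) \<Longrightarrow> - p \<in> carrier (free_algebra L)"
  by (auto simp: free_carrier in_keys_iff)
lemma fc_diff: "p \<in> carrier (free_algebra L) \<Longrightarrow> q \<in> carrier (free_algebra L) \<Longrightarrow> p - q \<in> carrier (free_algebra L)"
  using fc_add[of p L "- q"] fc_uminus[of q L] by simp
lemma fc_const: "const a \<in> carrier (free_algebra L)"
  by (simp add: free_carrier const_def)
lemma fc_0: "0 \<in> carrier (free_algebra L)" by (simp add: free_carrier)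
lemma fc_1: "1 \<in> carrier (free_algebra L)" using fc_const[of 1] by simp
lemma fc_gen: "l \<in> L \<Longrightarrow> gen l \<in> carrier (free_algebra L)"
  by (simp add: free_carrier gen_def)
lemma fc_sum: "(\<And>i. i \<in> A \<Longrightarrow> f i \<in> carrier (free_algebra L)) \<Longrightarrow> sum f A \<in> carrier (free_algebra L)"
  by (induction A rule: infinite_finite_induct) (auto intro: fc_add fc_0)
lemma fc_prod_list: "(\<And>i. i \<in> set xs \<Longrightarrow> f i \<in> carrier (free_algebra L)) \<Longrightarrow> prod_list (map f xs) \<in> carrier (free_algebra L)"
  by (induction xs) (auto intro: fc_mult fc_1)
lemmas fc = fc_add fc_mult fc_uminus fc_diff fc_const fc_0 fc_1 fc_gen fc_sum

lemma ring_free: "ring (free_algebra L)"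
proof (rule ringI)
  show "abelian_group (free_algebra L)"
    by (rule abelian_groupI) (auto intro: fc simp: add.assoc add.commute intro!: bexI[of _ "- _"])
  show "Group.monoid (free_algebra L)"
    by (rule monoidI) (auto intro: fc simp: mult.assoc)
qed (auto simp: distrib_left distrib_right)

lemma free_a_inv: assumes "p \<in> carrier (free_algebra L)" shows "\<ominus>\<^bsub>free_algebra L\<^esub> p = - p"
proof -
  interpret ring "free_algebra L" by (rule ring_free)
  show ?thesis by (rule minus_equality) (use assms in \<open>auto intro: fc\<close>)
qed
lemma free_a_minus: assumes "p \<in> carrier (free_algebra L)" "q \<in> carrier (free_algebra L)"
  shows "p \<ominus>\<^bsub>free_algebra L\<^esub> q = p - q"
  using assms by (simp add: a_minus_def free_a_inv)

definition subst :: "('l \<Rightarrow> 'm list \<Rightarrow>\<^sub>0 complex) \<Rightarrow> ('l list \<Rightarrow>\<^sub>0 complex) \<Rightarrow> ('m list \<Rightarrow>\<^sub>0 complex)" where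
  "subst f p = (\<Sum>u\<in>Poly_Mapping.keys p. const (Poly_Mapping.lookup p u) * prod_list (map f u))"

lemma subst_add: "subst f (p + q) = subst f p + subst f q"
  unfolding subst_def
  by (rule setsum_keys_plus_distrib) (simp_all add: distrib_right)
lemma subst_single: "subst f (Poly_Mapping.single u a) = const a * prod_list (map f u)"
  by (simp add: subst_def)
lemma subst_0: "subst f 0 = 0" by (simp add: subst_def)
lemma subst_const: "subst f (const a) = const a"
  unfolding const_def[of a] subst_single by (simp add: const_def)
lemma subst_1: "subst f 1 = 1" using subst_const[of f 1] by simp
lemma subst_gen: "subst f (gen l) = f l" by (simp add: gen_def subst_single)
lemma subst_mult: "subst f (p * q) = subst f p * subst f q"
proof (induction p rule: free_induct)
  case zero then show ?case by (simp add: subst_0)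
next
  case (add p p') then show ?case by (simp add: subst_add distrib_right)
next
  case (single u a)
  show ?case
  proof (induction q rule: free_induct)
    case zero then show ?case by (simp add: subst_0)
  next
    case (add p p') then show ?case by (simp add: subst_add distrib_left)
  next
    case (single v b)
    show ?case
      by (simp add: single_mult_list subst_single mult.assoc)
        (metis const_commute mult.assoc)
  qed
qed
lemma subst_uminus: "subst f (- p) = - subst f p"
  using subst_add[of f p "- p"] by (simp add: subst_0 eq_neg_iff_add_eq_0 add.commute)
lemma subst_diff: "subst f (p - q) = subst f p - subst f q"
  using subst_add[of f p "- q"] by (simp add: subst_uminus)
lemma subst_sum: "subst f (sum h A) = (\<Sum>i\<in>A. subst f (h i))"
  by (induction A rule: infinite_finite_induct) (auto simp: subst_0 subst_add)
lemmas subst_simps = subst_add subst_0 subst_const subst_1 subst_gen subst_mult subst_diff subst_sum subst_uminus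

lemma fc_subst:
  assumes "\<And>l. l \<in> L \<Longrightarrow> f l \<in> carrier (free_algebra M)" "p \<in> carrier (free_algebra L)"
  shows "subst f p \<in> carrier (free_algebra M)"
  unfolding subst_def using assms
  by (intro fc_sum fc_mult fc_const fc_prod_list) (auto simp: free_carrier)

lemma subst_id:
  assumes "\<And>l. l \<in> L \<Longrightarrow> f l = gen l" "p \<in> carrier (free_algebra L)"
  shows "subst f p = p"
proof -
  have 1: "prod_list (map gen u) = Poly_Mapping.single u 1" for u :: "'a list"
    by (induction u) (auto simp: one_free gen_def single_mult_list)
  have 2: "sum (\<lambda>u. Poly_Mapping.single u (Poly_Mapping.lookup p u)) (Poly_Mapping.keys p) = p"
    by (rule poly_mapping_eqI) (simp add: lookup_sum lookup_single when_def in_keys_iff)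
  have "subst f p = (\<Sum>u\<in>Poly_Mapping.keys p. const (Poly_Mapping.lookup p u) * prod_list (map gen u))"
    unfolding subst_def
    by (intro sum.cong refl arg_cong2[of _ _ _ _ "(*)"] arg_cong[of _ _ prod_list] map_cong)
      (use assms in \<open>auto simp: free_carrier\<close>)
  also have "\<dots> = p" using 2 by (simp add: 1 const_def single_mult_list)
  finally show ?thesis .
qed

lemma subst_subst: "subst f (subst h p) = subst (\<lambda>l. subst f (h l)) p"
proof (induction p rule: free_induct)
  case (single u a)
  have "subst f (prod_list (map h u)) = prod_list (map (\<lambda>l. subst f (h l)) u)"
    by (induction u) (auto simp: subst_simps)
  then show ?case by (simp add: subst_single subst_mult subst_const)
qed (simp_all add: subst_simps)


context
  fixes L :: "'l set" and I
  assumes I: "ideal I (free_algebra L)"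
begin
lemma id_carr: "p \<in> I \<Longrightarrow> p \<in> carrier (free_algebra L)"
  by (rule ideal.Icarr[OF I])
lemma id_add: "p \<in> I \<Longrightarrow> q \<in> I \<Longrightarrow> p + q \<in> I"
  using additive_subgroup.a_closed[OF ideal.axioms(1)[OF I]] by simp
lemma id_0: "0 \<in> I"
  using additive_subgroup.zero_closed[OF ideal.axioms(1)[OF I]] by simp
lemma id_uminus: "p \<in> I \<Longrightarrow> - p \<in> I"
  using additive_subgroup.a_inv_closed[OF ideal.axioms(1)[OF I], of p] free_a_inv[OF id_carr, of p]
    ring.is_abelian_group[OF ring_free] by (metis)
lemma id_diff: "p \<in> I \<Longrightarrow> q \<in> I \<Longrightarrow> p - q \<in> I"
  using id_add[of p "- q"] id_uminus[of q] by simp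
lemma id_l: "p \<in> I \<Longrightarrow> q \<in> carrier (free_algebra L) \<Longrightarrow> q * p \<in> I"
  using ideal.I_l_closed[OF I] by simp
lemma id_r: "p \<in> I \<Longrightarrow> q \<in> carrier (free_algebra L) \<Longrightarrow> p * q \<in> I"
  using ideal.I_r_closed[OF I] by simp
lemma id_c: "p \<in> I \<Longrightarrow> const a * p \<in> I" by (rule id_l[OF _ fc_const])
lemma cls_eq: "p \<in> carrier (free_algebra L) \<Longrightarrow> q \<in> carrier (free_algebra L) \<Longrightarrow>
   I +>\<^bsub>free_algebra L\<^esub> p = I +>\<^bsub>free_algebra L\<^esub> q \<longleftrightarrow> p - q \<in> I"
  using ring.quotient_eq_iff_same_a_r_cos[OF ring_free I, of p q] by (simp add: free_a_minus)
end

lemma subst_Idl: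
  assumes R: "R \<subseteq> carrier (free_algebra L)" and f: "\<And>l. l \<in> L \<Longrightarrow> f l \<in> carrier (free_algebra L)"
    and r: "\<And>r. r \<in> R \<Longrightarrow> subst f r \<in> Idl\<^bsub>free_algebra L\<^esub> R"
    and p: "p \<in> Idl\<^bsub>free_algebra L\<^esub> R"
  shows "subst f p \<in> Idl\<^bsub>free_algebra L\<^esub> R"
proof -
  let ?F = "free_algebra L" and ?I = "Idl\<^bsub>free_algebra L\<^esub> R"
  interpret ring ?F by (rule ring_free)
  have I: "ideal ?I ?F" by (rule genideal_ideal[OF R])
  let ?J = "{p \<in> carrier ?F. subst f p \<in> ?I}"
  have "ideal ?J ?F"
  proof (rule idealI[OF ring_free])
    show "subgroup ?J (add_monoid ?F)"
    proof (rule add.subgroupI)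
      fix a assume "a \<in> ?J"
      then show "\<ominus>\<^bsub>?F\<^esub> a \<in> ?J" by (auto simp: free_a_inv subst_simps intro: fc id_uminus[OF I])
    next
      show "?J \<noteq> {}" using id_0[OF I] fc_0[of L] subst_0[of f] by force
    qed (auto simp: subst_simps intro: fc id_add[OF I])
  qed (auto simp: subst_simps intro: fc id_l[OF I] id_r[OF I] fc_subst f)
  then have "?I \<subseteq> ?J" by (rule genideal_minimal) (use R r in auto)
  then show ?thesis using p by blast
qed

lemma subst_quot_hom:
  fixes L :: "'l set"
  defines "F \<equiv> free_algebra L"
  assumes I: "ideal I F" and f: "\<And>l. l \<in> L \<Longrightarrow> f l \<in> carrier F"
    and r: "\<And>p. p \<in> I \<Longrightarrow> subst f p \<in> I"
  obtains \<phi> where "\<phi> \<in> ring_hom (F Quot I) (F Quot I)"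
    "\<And>p. p \<in> carrier F \<Longrightarrow> \<phi> (I +>\<^bsub>F\<^esub> p) = I +>\<^bsub>F\<^esub> subst f p"
proof -
  interpret ideal I F by (rule I)
  have h: "(+>\<^bsub>F\<^esub>) I \<in> ring_hom F (F Quot I)" by (rule rcos_ring_hom)
  define \<phi> where "\<phi> X = (\<Union>p\<in>X. I +>\<^bsub>F\<^esub> subst f p)" for X
  have \<phi>: "\<phi> (I +>\<^bsub>F\<^esub> p) = I +>\<^bsub>F\<^esub> subst f p" if p: "p \<in> carrier F" for p
  proof -
    have "I +>\<^bsub>F\<^esub> subst f q = I +>\<^bsub>F\<^esub> subst f p" if q: "q \<in> I +>\<^bsub>F\<^esub> p" for q
    proof -
      obtain i where i: "i \<in> I" "q = i + p" using q by (auto simp: a_r_coset_def' F_def)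
      have "q \<in> carrier F" using i p Icarr unfolding F_def by (auto intro: fc)
      then have "subst f q \<in> carrier F" "subst f p \<in> carrier F"
        using f p unfolding F_def by (auto intro: fc_subst)
      then show ?thesis
        using i r cls_eq[OF I[unfolded F_def]] by (simp add: F_def subst_simps)
    qed
    moreover have "p \<in> I +>\<^bsub>F\<^esub> p" using p by (rule a_rcos_self)
    ultimately show ?thesis unfolding \<phi>_def by blast
  qed
  have surj: "\<exists>p\<in>carrier F. X = I +>\<^bsub>F\<^esub> p" if "X \<in> carrier (F Quot I)" for X
    using that by (auto simp: FactRing_def A_RCOSETS_def')
  have sc: "subst f p \<in> carrier F" if "p \<in> carrier F" for p
    using that f unfolding F_def by (auto intro: fc_subst)
  have "\<phi> \<in> ring_hom (F Quot I) (F Quot I)"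
  proof (rule ring_hom_memI)
    fix X assume "X \<in> carrier (F Quot I)"
    then obtain p where "p \<in> carrier F" "X = I +>\<^bsub>F\<^esub> p" using surj by blast
    then show "\<phi> X \<in> carrier (F Quot I)"
      using \<phi>[of p] ring_hom_closed[OF h sc[of p]] by metis
  next
    show "\<phi> (X \<otimes>\<^bsub>F Quot I\<^esub> Y) = \<phi> X \<otimes>\<^bsub>F Quot I\<^esub> \<phi> Y" "\<phi> (X \<oplus>\<^bsub>F Quot I\<^esub> Y) = \<phi> X \<oplus>\<^bsub>F Quot I\<^esub> \<phi> Y"
      if XY: "X \<in> carrier (F Quot I)" "Y \<in> carrier (F Quot I)" for X Y
    proof -
      obtain p where p: "p \<in> carrier F" "X = I +>\<^bsub>F\<^esub> p" using surj[OF XY(1)] by blast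
      obtain q where q: "q \<in> carrier F" "Y = I +>\<^bsub>F\<^esub> q" using surj[OF XY(2)] by blast
      note pq = p(1) q(1) p(2) q(2)
      show "\<phi> (X \<otimes>\<^bsub>F Quot I\<^esub> Y) = \<phi> X \<otimes>\<^bsub>F Quot I\<^esub> \<phi> Y"
        unfolding pq(3,4) \<phi>[OF pq(1)] \<phi>[OF pq(2)] ring_hom_mult[OF h pq(1,2), symmetric] ring_hom_mult[OF h sc[OF pq(1)] sc[OF pq(2)], symmetric] \<phi>[OF m_closed[OF pq(1,2)]]
        by (simp add: F_def subst_simps)
      show "\<phi> (X \<oplus>\<^bsub>F Quot I\<^esub> Y) = \<phi> X \<oplus>\<^bsub>F Quot I\<^esub> \<phi> Y"
        unfolding pq(3,4) \<phi>[OF pq(1)] \<phi>[OF pq(2)] ring_hom_add[OF h pq(1,2), symmetric] ring_hom_add[OF h sc[OF pq(1)] sc[OF pq(2)], symmetric] \<phi>[OF a_closed[OF pq(1,2)]]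
        by (simp add: F_def subst_simps)
    qed
    show "\<phi> \<one>\<^bsub>F Quot I\<^esub> = \<one>\<^bsub>F Quot I\<^esub>"
      unfolding ring_hom_one[OF h, symmetric] \<phi>[OF one_closed] by (simp add: F_def subst_simps)
  qed
  then show ?thesis using \<phi> that by blast
qed

lemma clf: 
  fixes f :: "complex^'n \<Rightarrow> complex"
  shows "clinear_functional f \<longleftrightarrow> (\<forall>u v. f (u + v) = f u + f v) \<and> (\<forall>a v. f (a *s v) = a * f v)"
  by (auto simp: Vector_Spaces.linear_iff vec.vector_space_axioms vector_space_over_itself.vector_space_axioms)

lemma cform_commute: "cform u v = cform v u"
  by (simp add: cform_def mult.commute)
lemma cform_simps: "cform (u + u') v = cform u v + cform u' v" "cform u (v + v') = cform u v + cform u v'"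
   "cform (a *s u) v = a * cform u v" "cform u (a *s v) = a * cform u v"
   "cform (u - u') v = cform u v - cform u' v" "cform u (v - v') = cform u v - cform u v'"
  by (simp_all add: cform_def sum.distrib sum_distrib_left sum_subtractf algebra_simps)
lemma clf_cform: "clinear_functional (cform u)"
  by (simp add: clf cform_simps)

definition sharp :: "(complex^'n \<Rightarrow> complex) \<Rightarrow> complex^'n" where
  "sharp h = (\<chi> i. h (axis i 1))"
lemma cform_axis: "cform u (axis i 1) = u $ i"
  by (simp add: cform_def axis_def if_distrib cong: if_cong)
lemma sharp_cform [simp]: "sharp (cform u) = u"
  by (simp add: sharp_def cform_axis vec_eq_iff)
lemma cform_sharp: fixes h :: "complex^'n \<Rightarrow> complex" assumes "clinear_functional h" shows "cform (sharp h) = h"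
proof
  fix v :: "complex^'n"
  have s: "h (sum g A) = (\<Sum>i\<in>A. h (g i))" for g :: "'n \<Rightarrow> complex^'n" and A
  proof (induction A rule: infinite_finite_induct)
    case (infinite A)
    have "h (0 *s 0) = 0 * h 0" using assms unfolding clf by blast
    then have "h 0 = 0" by simp
    then show ?case using infinite by simp
  next
    case empty
    have "h (0 *s 0) = 0 * h 0" using assms unfolding clf by blast
    then have "h 0 = 0" by simp
    then show ?case by simp
  next
    case (insert x F) then show ?case using assms by (simp add: clf)
  qed
  have "h v = h (\<Sum>i\<in>UNIV. v $ i *s axis i 1)"
    by (subst basis_expansion) simp
  also have "\<dots> = cform (sharp h) v"
    unfolding s using assms by (simp add: clf cform_def sharp_def mult.commute)
  finally show "cform (sharp h) v = h v" ..
qed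
lemma clf_E: assumes "clinear_functional h" obtains u where "h = cform u"
  using cform_sharp[OF assms] by metis

lemma cvec_simps: "cvec (u + v) = cvec u + cvec v" "cvec (a *\<^sub>R v) = complex_of_real a *s cvec v" "cvec (u - v) = cvec u - cvec v"
  by (simp_all add: cvec_def vec_eq_iff)
lemma Re_cvec: "(\<chi> i. Re (cvec v $ i)) = v" "(\<chi> i. Im (cvec v $ i)) = 0"
  by (simp_all add: cvec_def vec_eq_iff)
lemma cvec_split: "cvec (\<chi> i. Re (v $ i)) + \<i> *s cvec (\<chi> i. Im (v $ i)) = v"
  by (simp add: cvec_def vec_eq_iff complex_eq_iff)
lemma cform_cvec: "cform (cvec u) (cvec v) = complex_of_real (u \<bullet> v)"
  by (simp add: cform_def cvec_def inner_vec_def)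

lemma complexify_add: assumes "linear w" shows "complexify w (u + v) = complexify w u + complexify w v"
proof -
  have "(\<chi> i. Re ((u + v) $ i)) = (\<chi> i. Re (u $ i)) + (\<chi> i. Re (v $ i))"
       "(\<chi> i. Im ((u + v) $ i)) = (\<chi> i. Im (u $ i)) + (\<chi> i. Im (v $ i))"
    by (simp_all add: vec_eq_iff)
  then show ?thesis unfolding complexify_def using assms
    by (simp only: linear_add cvec_simps) (simp add: vector_add_ldistrib)
qed
lemma complexify_scale: assumes "linear w" shows "complexify w (a *s u) = a *s complexify w u"
proof -
  have 1: "(\<chi> i. Re ((a *s u) $ i)) = Re a *\<^sub>R (\<chi> i. Re (u $ i)) - Im a *\<^sub>R (\<chi> i. Im (u $ i))"
       "(\<chi> i. Im ((a *s u) $ i)) = Re a *\<^sub>R (\<chi> i. Im (u $ i)) + Im a *\<^sub>R (\<chi> i. Re (u $ i))"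
    by (simp_all add: vec_eq_iff)
  show ?thesis unfolding complexify_def 1 using assms
    by (simp only: linear_add linear_diff linear_cmul cvec_simps) (simp add: vec_eq_iff complex_eq_iff algebra_simps)
qed
lemma complexify_cvec: assumes "linear w" shows "complexify w (cvec v) = cvec (w v)"
  unfolding complexify_def Re_cvec using linear_0[OF assms] by (simp add: cvec_def vec_eq_iff)
lemma complexify_comp: assumes "linear w" "linear w'" shows "complexify w (complexify w' v) = complexify (w \<circ> w') v"
  unfolding complexify_def[of w' v] complexify_add[OF assms(1)] complexify_scale[OF assms(1)] complexify_cvec[OF assms(1)]
  by (simp add: complexify_def)
lemma complexify_id: "complexify id v = v"
  by (simp add: complexify_def cvec_split)

lemma cform_complexify: assumes "orthogonal_transformation w"
  shows "cform (complexify w u) (complexify w v) = cform u v"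
proof -
  have l: "linear w" and i: "\<And>a b. w a \<bullet> w b = a \<bullet> b"
    using assms by (auto simp: orthogonal_transformation_def)
  have *: "cform u v = cform (cvec (\<chi> i. Re (u $ i)) + \<i> *s cvec (\<chi> i. Im (u $ i))) (cvec (\<chi> i. Re (v $ i)) + \<i> *s cvec (\<chi> i. Im (v $ i)))"
    by (simp only: cvec_split)
  show ?thesis unfolding * complexify_def cform_simps cform_cvec i ..
qed

context
  fixes W :: "(real^'n \<Rightarrow> real^'n) set"
  assumes W: "finite_reflection_group W"
begin

lemma W_sub: "subgroup W orth_group" and W_fin: "finite W"
  using W by (auto simp: finite_reflection_group_def)
lemma W_orth: "w \<in> W \<Longrightarrow> orthogonal_transformation w"
  using subgroup.mem_carrier[OF W_sub] by (simp add: orth_group_def)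
lemma W_lin: "w \<in> W \<Longrightarrow> linear w"
  using W_orth orthogonal_transformation_linear by blast
lemma W_id: "id \<in> W"
  using subgroup.one_closed[OF W_sub] by (simp add: orth_group_def)
lemma W_comp: "w \<in> W \<Longrightarrow> w' \<in> W \<Longrightarrow> w \<circ> w' \<in> W"
  using subgroup.m_closed[OF W_sub] by (simp add: orth_group_def)
lemma W_bij: "w \<in> W \<Longrightarrow> bij w"
  using W_orth orthogonal_transformation_bij by blast
lemma W_inv_orth: "w \<in> W \<Longrightarrow> orthogonal_transformation (inv_into UNIV w)"
  using W_orth orthogonal_transformation_inv by blast
lemma W_inv_lin: "w \<in> W \<Longrightarrow> linear (inv_into UNIV w)"
  using W_inv_orth orthogonal_transformation_linear by blast

lemma contragredient: assumes "w \<in> W"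
  shows "cform u \<circ> complexify (inv_into UNIV w) = cform (complexify w u)"
proof
  fix v
  have "w \<circ> inv_into UNIV w = id" using W_bij[OF assms] bij_is_surj surj_iff by blast
  then have "complexify w (complexify (inv_into UNIV w) v) = v"
    by (simp add: complexify_comp W_lin W_inv_lin assms complexify_id)
  then show "(cform u \<circ> complexify (inv_into UNIV w)) v = cform (complexify w u) v"
    using cform_complexify[OF W_orth[OF assms], of u "complexify (inv_into UNIV w) v"] by simp
qed

lemma root_prop:
  assumes R: "root_data W \<alpha> \<alpha>v" and s: "s \<in> reflections_in W"
  obtains k where "\<And>v. \<alpha> s v = k * cform v (\<alpha>v s)"
proof -
  obtain a where a: "a \<noteq> 0" "\<And>v. s v = v - (2 * (v \<bullet> a) / (a \<bullet> a)) *\<^sub>R a"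
    using s by (auto simp: reflections_in_def is_reflection_def)
  have lin: "linear s" using s W_lin by (auto simp: reflections_in_def)
  define q where "q = 2 / complex_of_real (a \<bullet> a)"
  have q: "q \<noteq> 0" using a by (simp add: q_def)
  have cx: "complexify s v = v - (q * cform v (cvec a)) *s cvec a" for v
  proof -
    have r: "complexify s (cvec x) = cvec x - (q * cform (cvec x) (cvec a)) *s cvec a" for x
      unfolding complexify_cvec[OF lin] a(2) cvec_simps cform_cvec q_def by simp
    have "complexify s v = complexify s (cvec (\<chi> i. Re (v $ i)) + \<i> *s cvec (\<chi> i. Im (v $ i)))"
      by (simp only: cvec_split)
    also have "\<dots> = (cvec (\<chi> i. Re (v $ i)) + \<i> *s cvec (\<chi> i. Im (v $ i))) - (q * cform (cvec (\<chi> i. Re (v $ i)) + \<i> *s cvec (\<chi> i. Im (v $ i))) (cvec a)) *s cvec a"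
      unfolding complexify_add[OF lin] complexify_scale[OF lin] r cform_simps
      by (simp add: vec_eq_iff algebra_simps)
    finally show ?thesis unfolding cvec_split .
  qed
  have e: "\<alpha> s v *s \<alpha>v s = (q * cform v (cvec a)) *s cvec a" for v
  proof -
    have "complexify s v = v - \<alpha> s v *s \<alpha>v s" using R s by (auto simp: root_data_def)
    then show ?thesis using cx[of v] by simp
  qed
  have qa: "q * cform (cvec a) (cvec a) = 2" using a by (simp add: q_def cform_cvec)
  have e1: "\<alpha> s (cvec a) *s \<alpha>v s = 2 *s cvec a" using e[of "cvec a"] qa by simp
  have ca: "cvec a \<noteq> 0" using a(1) by (auto simp: cvec_def vec_eq_iff)
  have nz: "\<alpha> s (cvec a) \<noteq> 0"
  proof
    assume "\<alpha> s (cvec a) = 0"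
    then show False using e1 ca by simp
  qed
  define m where "m = 2 / \<alpha> s (cvec a)"
  have m: "m \<noteq> 0" using nz by (simp add: m_def)
  have av: "\<alpha>v s = m *s cvec a"
  proof -
    have "\<alpha>v s = (1 / \<alpha> s (cvec a)) *s (\<alpha> s (cvec a) *s \<alpha>v s)" using nz by simp
    also have "\<dots> = m *s cvec a" unfolding e1 by (simp add: m_def)
    finally show ?thesis .
  qed
  have "\<alpha> s v = (q / m ^ 2) * cform v (\<alpha>v s)" for v
  proof -
    have "(\<alpha> s v * m) *s cvec a = (q * cform v (cvec a)) *s cvec a"
      using e[of v] unfolding av by simp
    then have "\<alpha> s v * m = q * cform v (cvec a)" using ca by simp
    then have "\<alpha> s v = q * cform v (cvec a) / m" using m by (simp add: field_simps)
    then show ?thesis unfolding av cform_simps using m by (simp add: power2_eq_square)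
  qed
  then show ?thesis using that by blast
qed

lemma letter_carr:
  "gen (Vec v) \<in> carrier (free_algebra (letters W))"
  "gen (Cov (cform v)) \<in> carrier (free_algebra (letters W))"
  "clinear_functional f \<Longrightarrow> gen (Cov f) \<in> carrier (free_algebra (letters W))"
  "w \<in> W \<Longrightarrow> gen (Grp w) \<in> carrier (free_algebra (letters W))"
  using clf_cform[of v] by (auto intro!: fc_gen simp: letters_def)

definition bracket where
  "bracket \<alpha> \<alpha>v t c y x = const (t * x y)
           - (\<Sum>s\<in>reflections_in W.
                const (2 * c s / \<alpha> s (\<alpha>v s) * x (\<alpha>v s) * \<alpha> s y) * gen (Grp s))"

lemma bracket_carr: "bracket \<alpha> \<alpha>v t c y x \<in> carrier (free_algebra (letters W))"
  unfolding bracket_def by (intro fc_diff fc_sum fc_mult fc_const letter_carr) (auto simp: reflections_in_def)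

lemma bracket_sym: assumes "root_data W \<alpha> \<alpha>v"
  shows "bracket \<alpha> \<alpha>v t c u (cform v) = bracket \<alpha> \<alpha>v t c v (cform u)"
proof -
  have "cform v (\<alpha>v s) * \<alpha> s u = cform u (\<alpha>v s) * \<alpha> s v" if "s \<in> reflections_in W" for s
    using root_prop[OF assms that] by (metis mult.left_commute mult.commute)
  then have "(\<Sum>s\<in>reflections_in W. const (2 * c s / \<alpha> s (\<alpha>v s) * cform v (\<alpha>v s) * \<alpha> s u) * gen (Grp s))
   = (\<Sum>s\<in>reflections_in W. const (2 * c s / \<alpha> s (\<alpha>v s) * cform u (\<alpha>v s) * \<alpha> s v) * gen (Grp s))"
    by (intro sum.cong refl) (simp only: mult.assoc)
  then show ?thesis unfolding bracket_def by (simp only: cform_commute[of v u])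
qed

lemma rels_carr: "semidirect_relations W \<union> cherednik_relations W \<alpha> \<alpha>v t c \<subseteq> carrier (free_algebra (letters W))"
proof -
  have "semidirect_relations W \<subseteq> carrier (free_algebra (letters W))"
    unfolding semidirect_relations_def
  proof (intro Un_least subsetI; (elim CollectE exE conjE singletonE)?; hypsubst)
    fix f h :: "complex^'n \<Rightarrow> complex" assume fh: "clinear_functional f" "clinear_functional h"
    then have "clinear_functional (\<lambda>v. f v + h v)" by (simp add: clf algebra_simps)
    with fh show "gen (Cov (\<lambda>v. f v + h v)) - (gen (Cov f) + gen (Cov h)) \<in> carrier (free_algebra (letters W))"
      by (intro fc_diff fc_add letter_carr)
  next
    fix f :: "complex^'n \<Rightarrow> complex" and a assume fh: "clinear_functional f"
    then have "clinear_functional (\<lambda>v. a * f v)" by (simp add: clf algebra_simps)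
    with fh show "gen (Cov (\<lambda>v. a * f v)) - const a * gen (Cov f) \<in> carrier (free_algebra (letters W))"
      by (intro fc letter_carr)
  next
    fix f :: "complex^'n \<Rightarrow> complex" and w assume fh: "clinear_functional f" and w: "w \<in> W"
    obtain u where u: "f = cform u" using clf_E[OF fh] .
    show "gen (Grp w) * gen (Cov f) - gen (Cov (f \<circ> complexify (inv_into UNIV w))) * gen (Grp w) \<in> carrier (free_algebra (letters W))"
      unfolding u contragredient[OF w] by (intro fc_diff fc_mult letter_carr w)
  qed (intro fc_diff fc_add fc_mult fc_const fc_1 letter_carr W_id W_comp | assumption)+
  moreover have "cherednik_relations W \<alpha> \<alpha>v t c \<subseteq> carrier (free_algebra (letters W))"
    unfolding cherednik_relations_def bracket_def[symmetric] commutator_def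
    by (auto intro!: fc_diff fc_mult letter_carr bracket_carr)
  ultimately show ?thesis by blast
qed

context
  fixes \<alpha> :: "(real^'n \<Rightarrow> real^'n) \<Rightarrow> complex^'n \<Rightarrow> complex" and \<alpha>v :: "(real^'n \<Rightarrow> real^'n) \<Rightarrow> complex^'n"
    and t :: complex and c :: "(real^'n \<Rightarrow> real^'n) \<Rightarrow> complex"
  assumes R: "root_data W \<alpha> \<alpha>v"
begin

abbreviation "CI \<equiv> cherednik_ideal W \<alpha> \<alpha>v t c"
lemma CI: "ideal CI (free_algebra (letters W))"
  unfolding cherednik_ideal_def by (rule ring.genideal_ideal[OF ring_free rels_carr])
lemma CI_rel: "r \<in> semidirect_relations W \<union> cherednik_relations W \<alpha> \<alpha>v t c \<Longrightarrow> r \<in> CI"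
  unfolding cherednik_ideal_def using ring.genideal_self[OF ring_free rels_carr] by blast

lemma CI_rels:
  "gen (Vec (u + v)) - (gen (Vec u) + gen (Vec v)) \<in> CI"
  "gen (Vec (a *s v)) - const a * gen (Vec v) \<in> CI"
  "gen (Cov (cform (u + v))) - (gen (Cov (cform u)) + gen (Cov (cform v))) \<in> CI"
  "gen (Cov (cform (a *s v))) - const a * gen (Cov (cform v)) \<in> CI"
  "w \<in> W \<Longrightarrow> gen (Grp w) * gen (Vec v) - gen (Vec (complexify w v)) * gen (Grp w) \<in> CI"
  "w \<in> W \<Longrightarrow> gen (Grp w) * gen (Cov (cform v)) - gen (Cov (cform (complexify w v))) * gen (Grp w) \<in> CI"
  "commutator (gen (Vec u)) (gen (Vec v)) \<in> CI"
  "commutator (gen (Cov (cform u))) (gen (Cov (cform v))) \<in> CI"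
  "commutator (gen (Vec u)) (gen (Cov (cform v))) - bracket \<alpha> \<alpha>v t c u (cform v) \<in> CI"
proof -
  have e: "cform (u + v) = (\<lambda>x. cform u x + cform v x)" "cform (a *s v) = (\<lambda>x. a * cform v x)"
    by (auto simp: cform_simps)
  note clf_cform[of u] clf_cform[of v]
  note m = CI_rel[unfolded semidirect_relations_def cherednik_relations_def bracket_def[symmetric]]
  show "gen (Vec (u + v)) - (gen (Vec u) + gen (Vec v)) \<in> CI"
    by (rule m) blast
  show "gen (Vec (a *s v)) - const a * gen (Vec v) \<in> CI"
    by (rule m) blast
  show "gen (Cov (cform (u + v))) - (gen (Cov (cform u)) + gen (Cov (cform v))) \<in> CI"
    unfolding e by (rule m, rule UnI1, rule UnI1, rule UnI1, rule UnI1, rule UnI1, rule UnI1, rule UnI2, rule CollectI,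
      rule exI[of _ "cform u"], rule exI[of _ "cform v"]) (simp add: clf_cform)
  show "gen (Cov (cform (a *s v))) - const a * gen (Cov (cform v)) \<in> CI"
    unfolding e by (rule m, rule UnI1, rule UnI1, rule UnI1, rule UnI1, rule UnI1, rule UnI2, rule CollectI,
      rule exI[of _ a], rule exI[of _ "cform v"]) (simp add: clf_cform)
  show "gen (Grp w) * gen (Vec v) - gen (Vec (complexify w v)) * gen (Grp w) \<in> CI" if "w \<in> W"
    by (rule m) (use that in blast)
  show "gen (Grp w) * gen (Cov (cform v)) - gen (Cov (cform (complexify w v))) * gen (Grp w) \<in> CI" if "w \<in> W"
    unfolding contragredient[OF that, symmetric]
    by (rule m, rule UnI1, rule UnI2, rule CollectI, rule exI[of _ w], rule exI[of _ "cform v"]) (simp add: clf_cform that)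
  show "commutator (gen (Vec u)) (gen (Vec v)) \<in> CI"
    by (rule m) blast
  show "commutator (gen (Cov (cform u))) (gen (Cov (cform v))) \<in> CI"
    by (rule m, rule UnI2, rule UnI1, rule UnI1, rule CollectI, rule exI[of _ "cform u"], rule exI[of _ "cform v"])
      (simp add: clf_cform)
  show "commutator (gen (Vec u)) (gen (Cov (cform v))) - bracket \<alpha> \<alpha>v t c u (cform v) \<in> CI"
    by (rule m, rule UnI2, rule UnI2, rule CollectI, rule exI[of _ "cform v"], rule exI[of _ u])
      (simp add: clf_cform)
qed

definition act :: "complex^2^2 \<Rightarrow> 'n letter \<Rightarrow> 'n free" where
  "act g l = (case l of
     Vec v \<Rightarrow> const (g$1$1) * gen (Vec v) + const (g$1$2) * gen (Cov (cform v))
   | Cov f \<Rightarrow> const (g$2$1) * gen (Vec (sharp f)) + const (g$2$2) * gen (Cov f)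
   | Grp w \<Rightarrow> gen (Grp w))"

lemma act_carr: "l \<in> letters W \<Longrightarrow> act g l \<in> carrier (free_algebra (letters W))"
  by (auto simp: act_def split: letter.split intro!: fc_add fc_mult fc_const letter_carr)
    (auto simp: letters_def intro!: letter_carr)

lemma comm_expand:
  fixes A B C D :: "'l list \<Rightarrow>\<^sub>0 complex"
  shows "commutator (const a * A + const b * B) (const d * C + const e * D) =
    const (a * d) * commutator A C + const (a * e) * commutator A D + const (b * d) * commutator B C + const (b * e) * commutator B D"
proof -
  have 1: "const x * X * (const y * Y) = const (x * y) * (X * Y)" for x y :: complex and X Y :: "'l list \<Rightarrow>\<^sub>0 complex"
  proof -
    have "const x * X * (const y * Y) = const x * (X * const y) * Y" by (simp add: mult.assoc)
    also have "\<dots> = const x * (const y * X) * Y" by (simp only: const_commute)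
    finally show ?thesis by (simp add: mult.assoc)
  qed
  show ?thesis unfolding commutator_def
    by (simp only: distrib_left distrib_right 1 right_diff_distrib) (simp add: mult.commute[of d] mult.commute[of e])
qed

lemma act_rel:
  assumes g: "det g = 1" and r: "r \<in> semidirect_relations W \<union> cherednik_relations W \<alpha> \<alpha>v t c"
  shows "subst (act g) r \<in> CI"
proof -
  note I = CI
  let ?a = "g$1$1" and ?b = "g$1$2" and ?c = "g$2$1" and ?d = "g$2$2"
  have det: "?a * ?d - ?b * ?c = 1" using g by (simp add: det_2)
  have V: "act g (Vec v) = const ?a * gen (Vec v) + const ?b * gen (Cov (cform v))" for v by (simp add: act_def)
  have C: "act g (Cov (cform v)) = const ?c * gen (Vec v) + const ?d * gen (Cov (cform v))" for v by (simp add: act_def)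
  have G: "act g (Grp w) = gen (Grp w)" for w by (simp add: act_def)
  have lin1: "const x * P + const y * Q - ((const x * P1 + const y * Q1) + (const x * P2 + const y * Q2)) =
     const x * (P - (P1 + P2)) + const y * (Q - (Q1 + Q2))" for x y and P Q P1 Q1 P2 Q2 :: "'n free"
    by (simp add: algebra_simps)
  have lin2: "const x * P + const y * Q - const z * (const x * P1 + const y * Q1) =
     const x * (P - const z * P1) + const y * (Q - const z * Q1)" for x y z and P Q P1 Q1 P2 Q2 :: "'n free"
  proof -
    have "const z * (const x * P1) = const x * (const z * P1)" "const z * (const y * Q1) = const y * (const z * Q1)"
      by (metis const_commute mult.assoc)+
    then show ?thesis by (simp add: algebra_simps)
  qed
  have lin3: "w * (const x * P + const y * Q) - (const x * P1 + const y * Q1) * w =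
     const x * (w * P - P1 * w) + const y * (w * Q - Q1 * w)" for x y and w P Q P1 Q1 :: "'n free"
  proof -
    have "w * (const x * P) = const x * (w * P)" "w * (const y * Q) = const y * (w * Q)"
      by (metis const_commute mult.assoc)+
    then show ?thesis by (simp add: algebra_simps)
  qed
  have comm: "subst (act g) (commutator p q) = commutator (subst (act g) p) (subst (act g) q)" for p q
    by (simp add: commutator_def subst_simps)
  have br: "subst (act g) (bracket \<alpha> \<alpha>v t c y x) = bracket \<alpha> \<alpha>v t c y x" for y x
    unfolding bracket_def subst_simps G ..
  have sym: "bracket \<alpha> \<alpha>v t c v (cform u) = bracket \<alpha> \<alpha>v t c u (cform v)" for u v
    by (rule bracket_sym[OF R])
  have anti: "const x * commutator (gen (Vec u)) (gen (Cov (cform v))) + const y * commutator (gen (Cov (cform u))) (gen (Vec v))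
     - const (x - y) * bracket \<alpha> \<alpha>v t c u (cform v) \<in> CI" for x y u v
  proof -
    let ?K = "bracket \<alpha> \<alpha>v t c u (cform v)"
    let ?P = "commutator (gen (Vec u)) (gen (Cov (cform v))) - ?K"
    let ?Q = "commutator (gen (Vec v)) (gen (Cov (cform u))) - ?K"
    have "?P \<in> CI" "?Q \<in> CI" using CI_rels(9)[of u v] CI_rels(9)[of v u] by (simp_all add: sym)
    then have "const x * ?P - const y * ?Q \<in> CI" by (rule id_diff[OF I id_c[OF I] id_c[OF I]])
    also have "const x * ?P - const y * ?Q = const x * commutator (gen (Vec u)) (gen (Cov (cform v))) + const y * commutator (gen (Cov (cform u))) (gen (Vec v))
     - const (x - y) * ?K" by (simp add: commutator_def algebra_simps)
    finally show ?thesis .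
  qed
  have zero: "const (x - x) * p = 0" for x and p :: "'n free" by simp
  from r consider
     u v where "r = gen (Vec (u + v)) - (gen (Vec u) + gen (Vec v))"
   | a v where "r = gen (Vec (a *s v)) - const a * gen (Vec v)"
   | f h where "r = gen (Cov (\<lambda>v. f v + h v)) - (gen (Cov f) + gen (Cov h))" "clinear_functional f" "clinear_functional h"
   | a f where "r = gen (Cov (\<lambda>v. a * f v)) - const a * gen (Cov f)" "clinear_functional f"
   | "r = gen (Grp id) - 1"
   | w w' where "r = gen (Grp (w \<circ> w')) - gen (Grp w) * gen (Grp w')" "w \<in> W" "w' \<in> W"
   | w v where "r = gen (Grp w) * gen (Vec v) - gen (Vec (complexify w v)) * gen (Grp w)" "w \<in> W"
   | w f where "r = gen (Grp w) * gen (Cov f) - gen (Cov (f \<circ> complexify (inv_into UNIV w))) * gen (Grp w)" "w \<in> W" "clinear_functional f"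
   | x x' where "r = commutator (gen (Cov x)) (gen (Cov x'))" "clinear_functional x" "clinear_functional x'"
   | y y' where "r = commutator (gen (Vec y)) (gen (Vec y'))"
   | y x where "r = commutator (gen (Vec y)) (gen (Cov x)) - bracket \<alpha> \<alpha>v t c y x" "clinear_functional x"
    unfolding semidirect_relations_def cherednik_relations_def bracket_def[symmetric] by blast
  then show ?thesis
  proof cases
    case 1
    show ?thesis unfolding 1 subst_simps V lin1 by (intro id_add[OF I] id_c[OF I] CI_rels)
  next
    case 2
    show ?thesis unfolding 2 subst_simps V lin2 by (intro id_add[OF I] id_c[OF I] CI_rels)
  next
    case 3
    obtain u v where uv: "f = cform u" "h = cform v" using clf_E 3(2,3) by metis
    have e: "(\<lambda>x. cform u x + cform v x) = cform (u + v)" by (auto simp: cform_simps)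
    show ?thesis unfolding 3(1) uv e subst_simps C lin1 by (intro id_add[OF I] id_c[OF I] CI_rels)
  next
    case (4 a f)
    obtain v where uv: "f = cform v" using clf_E 4(2) by metis
    have e: "(\<lambda>x. a * cform v x) = cform (a *s v)" by (auto simp: cform_simps)
    show ?thesis unfolding 4(1) uv e subst_simps C lin2 by (intro id_add[OF I] id_c[OF I] CI_rels)
  next
    case 5
    have "subst (act g) r = r" unfolding 5 subst_simps G ..
    then show ?thesis using CI_rel[OF r] by simp
  next
    case 6
    have "subst (act g) r = r" unfolding 6 subst_simps G ..
    then show ?thesis using CI_rel[OF r] by simp
  next
    case 7
    show ?thesis unfolding 7(1) subst_simps V G lin3 by (intro id_add[OF I] id_c[OF I] CI_rels 7)
  next
    case (8 w f)
    obtain v where uv: "f = cform v" using clf_E 8(3) by metis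
    show ?thesis unfolding 8(1) uv contragredient[OF 8(2)] subst_simps C G lin3
      by (intro id_add[OF I] id_c[OF I] CI_rels 8)
  next
    case (9 x x')
    obtain u v where uv: "x = cform u" "x' = cform v" using clf_E 9(2,3) by metis
    have "const (?c * ?c) * commutator (gen (Vec u)) (gen (Vec v)) + const (?c * ?d) * commutator (gen (Vec u)) (gen (Cov (cform v)))
      + const (?d * ?c) * commutator (gen (Cov (cform u))) (gen (Vec v)) + const (?d * ?d) * commutator (gen (Cov (cform u))) (gen (Cov (cform v))) \<in> CI"
      (is "?A + ?B + ?C + ?D \<in> CI")
    proof -
      have "?B + ?C \<in> CI" using anti[of "?c * ?d" u v "?d * ?c"] unfolding mult.commute[of ?d ?c] zero by simp
      then have "?A + (?B + ?C) + ?D \<in> CI"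
        by (intro id_add[OF I id_add[OF I id_c[OF I]] id_c[OF I]] CI_rels)
      then show ?thesis by (simp only: add.assoc)
    qed
    then show ?thesis unfolding 9(1) uv comm subst_simps C comm_expand .
  next
    case (10 u v)
    have "const (?a * ?a) * commutator (gen (Vec u)) (gen (Vec v)) + const (?a * ?b) * commutator (gen (Vec u)) (gen (Cov (cform v)))
      + const (?b * ?a) * commutator (gen (Cov (cform u))) (gen (Vec v)) + const (?b * ?b) * commutator (gen (Cov (cform u))) (gen (Cov (cform v))) \<in> CI"
      (is "?A + ?B + ?C + ?D \<in> CI")
    proof -
      have "?B + ?C \<in> CI" using anti[of "?a * ?b" u v "?b * ?a"] unfolding mult.commute[of ?b ?a] zero by simp
      then have "?A + (?B + ?C) + ?D \<in> CI"
        by (intro id_add[OF I id_add[OF I id_c[OF I]] id_c[OF I]] CI_rels)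
      then show ?thesis by (simp only: add.assoc)
    qed
    then show ?thesis unfolding 10(1) comm subst_simps V comm_expand .
  next
    case (11 u x)
    obtain v where uv: "x = cform v" using clf_E 11(2) by metis
    let ?K = "bracket \<alpha> \<alpha>v t c u (cform v)"
    have "const (?a * ?c) * commutator (gen (Vec u)) (gen (Vec v)) + const (?a * ?d) * commutator (gen (Vec u)) (gen (Cov (cform v)))
      + const (?b * ?c) * commutator (gen (Cov (cform u))) (gen (Vec v)) + const (?b * ?d) * commutator (gen (Cov (cform u))) (gen (Cov (cform v))) - ?K \<in> CI"
      (is "?A + ?B + ?C + ?D - ?K \<in> CI")
    proof -
      have "const (1::complex) * ?K = ?K" by simp
      then have "?B + ?C - ?K \<in> CI" using anti[of "?a * ?d" u v "?b * ?c"] unfolding det by simp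
      then have "?A + (?B + ?C - ?K) + ?D \<in> CI"
        by (intro id_add[OF I id_add[OF I id_c[OF I]] id_c[OF I]] CI_rels)
      also have "?A + (?B + ?C - ?K) + ?D = ?A + ?B + ?C + ?D - ?K" by (simp only: add_diff_eq diff_add_eq add.assoc diff_diff_eq2)
      finally show ?thesis .
    qed
    then show ?thesis unfolding 11(1) uv subst_diff comm br subst_gen V C comm_expand .
  qed
qed

lemma act_quot:
  assumes "det g = 1"
  obtains \<phi> where "\<phi> \<in> ring_hom (cherednik_algebra W \<alpha> \<alpha>v t c) (cherednik_algebra W \<alpha> \<alpha>v t c)"
    "\<And>p. p \<in> carrier (free_algebra (letters W)) \<Longrightarrow>
       \<phi> (cherednik_class W \<alpha> \<alpha>v t c p) = cherednik_class W \<alpha> \<alpha>v t c (subst (act g) p)"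
proof -
  have 1: "subst (act g) p \<in> CI" if "p \<in> CI" for p
    using subst_Idl[OF rels_carr act_carr act_rel[OF assms, unfolded cherednik_ideal_def] that[unfolded cherednik_ideal_def]]
    unfolding cherednik_ideal_def by blast
  show ?thesis
    by (rule subst_quot_hom[OF CI act_carr 1]) (use that in \<open>auto simp: cherednik_algebra_def cherednik_class_def\<close>)
qed

lemma act_act:
  assumes "det g = 1" "g' = (\<chi> i j. if i = 1 then (if j = 1 then g$2$2 else - g$1$2) else (if j = 1 then - g$2$1 else g$1$1))"
    "p \<in> carrier (free_algebra (letters W))"
  shows "subst (act g') (subst (act g) p) = p" "subst (act g) (subst (act g') p) = p"
proof -
  have det: "g$1$1 * g$2$2 - g$1$2 * g$2$1 = 1" using assms by (simp add: det_2)
  have g': "g'$1$1 = g$2$2" "g'$1$2 = - g$1$2" "g'$2$1 = - g$2$1" "g'$2$2 = g$1$1" by (simp_all add: assms(2))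
  have aux: "const a * (const b * P + const d * Q) + const e * (const f * P + const h * Q) = P"
     if "a * b + e * f = 1" "a * d + e * h = 0" for a b d e f h and P Q :: "'n free"
  proof -
    have "const a * (const b * P + const d * Q) + const e * (const f * P + const h * Q) = const (a * b + e * f) * P + const (a * d + e * h) * Q"
      by (simp add: algebra_simps)
    then show ?thesis unfolding that by simp
  qed
  have aux2: "const a * (const d * Q + const b * P) + const e * (const h * Q + const f * P) = P"
     if "a * b + e * f = 1" "a * d + e * h = 0" for a b d e f h and P Q :: "'n free"
    using aux[OF that] by (simp only: add.commute)
  have l: "subst (act g') (act g l) = gen l" "subst (act g) (act g' l) = gen l" if "l \<in> letters W" for l
  proof -
    consider v where "l = Vec v" | u where "l = Cov (cform u)" | w where "l = Grp w"
    proof -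
      consider v where "l = Vec v" | f where "l = Cov f" "clinear_functional f" | w where "l = Grp w"
        using \<open>l \<in> letters W\<close> unfolding letters_def by blast
      then show ?thesis
      proof cases
        case (2 f)
        show ?thesis by (rule clf_E[OF 2(2)]) (use 2 that in blast)
      qed (use that in blast)+
    qed
    then have "subst (act g') (act g l) = gen l \<and> subst (act g) (act g' l) = gen l"
    proof cases
      case 1 show ?thesis unfolding 1 act_def letter.case subst_add subst_mult subst_const subst_gen g' sharp_cform
        by (intro conjI aux) (use det in \<open>auto simp: algebra_simps\<close>)
    next
      case 2 show ?thesis unfolding 2 act_def letter.case subst_add subst_mult subst_const subst_gen g' sharp_cform
        by (intro conjI aux2) (use det in \<open>auto simp: algebra_simps\<close>)
    next
      case 3 then show ?thesis by (simp add: act_def subst_simps)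
    qed
    then show "subst (act g') (act g l) = gen l" "subst (act g) (act g' l) = gen l" by auto
  qed
  show "subst (act g') (subst (act g) p) = p" "subst (act g) (subst (act g') p) = p"
    unfolding subst_subst by (rule subst_id[OF _ assms(3)], simp add: l)+
qed

lemma sl2_exists:
  assumes g: "det g = 1"
  shows "\<exists>\<phi>. sl2_automorphism W \<alpha> \<alpha>v t c g \<phi>"
proof -
  let ?H = "cherednik_algebra W \<alpha> \<alpha>v t c" and ?cls = "cherednik_class W \<alpha> \<alpha>v t c" and ?F = "free_algebra (letters W)"
  define g' :: "complex^2^2" where "g' = (\<chi> i j. if i = 1 then (if j = 1 then g$2$2 else - g$1$2) else (if j = 1 then - g$2$1 else g$1$1))"
  have dg: "det g' = 1" using g by (simp add: det_2 g'_def mult.commute)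
  obtain \<phi> where \<phi>: "\<phi> \<in> ring_hom ?H ?H" "\<And>p. p \<in> carrier ?F \<Longrightarrow> \<phi> (?cls p) = ?cls (subst (act g) p)"
    using act_quot[OF g] by blast
  obtain \<phi>' where \<phi>': "\<phi>' \<in> ring_hom ?H ?H" "\<And>p. p \<in> carrier ?F \<Longrightarrow> \<phi>' (?cls p) = ?cls (subst (act g') p)"
    using act_quot[OF dg] by blast
  have surj: "\<exists>p\<in>carrier ?F. X = ?cls p" if "X \<in> carrier ?H" for X
    using that by (auto simp: FactRing_def A_RCOSETS_def' cherednik_algebra_def cherednik_class_def)
  have inv: "\<phi>' (\<phi> X) = X" "\<phi> (\<phi>' X) = X" if X: "X \<in> carrier ?H" for X
  proof -
    obtain p where p: "p \<in> carrier ?F" "X = ?cls p" using surj[OF X] by blast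
    have c: "subst (act g) p \<in> carrier ?F" "subst (act g') p \<in> carrier ?F"
      by (rule fc_subst[OF _ p(1)], rule act_carr, assumption)+
    have "\<phi> X = ?cls (subst (act g) p)" unfolding p(2) by (rule \<phi>(2)[OF p(1)])
    moreover have "\<phi>' (?cls (subst (act g) p)) = ?cls (subst (act g') (subst (act g) p))" by (rule \<phi>'(2)[OF c(1)])
    ultimately show "\<phi>' (\<phi> X) = X" by (simp only: act_act(1)[OF g g'_def p(1)] p(2))
    have "\<phi>' X = ?cls (subst (act g') p)" unfolding p(2) by (rule \<phi>'(2)[OF p(1)])
    moreover have "\<phi> (?cls (subst (act g') p)) = ?cls (subst (act g) (subst (act g') p))" by (rule \<phi>(2)[OF c(2)])
    ultimately show "\<phi> (\<phi>' X) = X" by (simp only: act_act(2)[OF g g'_def p(1)] p(2))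
  qed
  have "bij_betw \<phi> (carrier ?H) (carrier ?H)"
    by (rule bij_betw_byWitness[of _ \<phi>']) (use inv ring_hom_closed[OF \<phi>(1)] ring_hom_closed[OF \<phi>'(1)] in auto)
  then have iso: "\<phi> \<in> ring_iso ?H ?H" using \<phi>(1) by (simp add: ring_iso_def)
  have "sl2_automorphism W \<alpha> \<alpha>v t c g \<phi>"
    unfolding sl2_automorphism_def Let_def using iso
    by (auto simp: \<phi>(2) fc_const letter_carr subst_simps act_def)
  then show ?thesis by blast
qed

end
end

end

theory Submission
  imports Defs
begin

text \<open>
  Write \<open>v\<^sup>*\<close> for the functional \<open>cform v\<close> and \<open>z a b v = a v + b v\<^sup>*\<close>; the matrix \<open>g\<close> acts by moving the row
  \<open>(a, b)\<close> to \<open>(a, b) g\<close> and leaves \<open>v\<close> alone. Everything is done with representatives in the free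
  algebra modulo the defining ideal, and the preimage of the angular momentum algebra there is called
  \<open>angular\<close>. That angular elements are invariant is a short computation
  (\<open>act_momentum\<close>): the momenta are determinants in the row variables, up to a term that the symmetry of
  the bracket \<open>[u, v\<^sup>*] = [v, u\<^sup>*]\<close> in \<open>u\<close> and \<open>v\<close> controls.

  For the converse one decomposes the Cherednik algebra under \<open>SL\<^sub>2\<close>. The classical model is the polynomial
  ring on \<open>V \<otimes> \<complex>\<^sup>2\<close>, which is spanned, over the algebra of \<open>2 \<times> 2\<close> minors, by products
  of linear forms that all use the same row \<open>(a, b)\<close>; the products of length \<open>d\<close> form copies of the
  irreducible module \<open>Sym\<^sup>d \<complex>\<^sup>2\<close>, and only \<open>d = 0\<close> contributes invariants. The same works here:

  \<^item> Every element is a sum of products \<open>word a b vs * q\<close> with \<open>q\<close> angular, where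
    \<open>word a b vs\<close> is the product of the letters \<open>z a b v\<close> for \<open>v\<close> in \<open>vs\<close>
    (\<open>all_in_right_span_words\<close>). To multiply such a word by a letter with another row, one replaces that
    letter by its average over all positions. The average lies in the span by polarization, and the
    difference is a sum of words with a momentum inserted, because exchanging the rows of two
    neighbouring letters costs a momentum (\<open>exchange\<close>) and momenta can be moved to the right
    (\<open>word_contraction_word\<close>).

  \<^item> In an invariant element, only the zero weight space of the diagonal torus survives
    (\<open>torus_expansion\<close>), so the lengths are even. If \<open>2 N > 0\<close> is the largest length, the top
    coefficient under the upper unipotent matrices says that the lowest weight vectors of that length
    sum to zero. The lower unipotent matrices recover the zero weight part from these
    vectors, so it vanishes too, and \<open>N\<close> drops (\<open>balanced_invariant_in_angular\<close>).

  Both steps compare polynomials in one parameter, with values in the Cherednik algebra, coefficient by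
  coefficient (\<open>polynomial_coefficients_in_subspace\<close>).
\<close>

section \<open>Polynomials with coefficients in a free algebra\<close>

lemma span_sum_mem:
  fixes V :: "('l list \<Rightarrow>\<^sub>0 complex) set"
  assumes "0 \<in> V" "\<And>p q. p \<in> V \<Longrightarrow> q \<in> V \<Longrightarrow> p + q \<in> V" "\<And>i. i \<in> A \<Longrightarrow> f i \<in> V"
  shows "sum f A \<in> V"
  using assms(3) by (induction A rule: infinite_finite_induct) (auto intro: assms(1,2))

lemma const_inverse_cancel:
  assumes "a \<noteq> 0" shows "const (inverse a) * (const a * p) = p"
proof -
  have "const (inverse a) * (const a * p) = const (inverse a * a) * p"
    by (simp only: const_simps(2) mult.assoc)
  then show ?thesis using assms by simp
qed

text \<open>This is the invertibility of the Vandermonde matrix, for values in a quotient by a subspace. Passing from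
\<open>p(s)\<close> to \<open>p(2 s) - 2\<^sup>N p(s)\<close> kills the top coefficient and multiplies the others by nonzero
scalars. Only nonzero \<open>s\<close> are allowed, because \<open>s\<close> will run over the torus as well as over unipotent groups.\<close>

lemma polynomial_coefficients_in_subspace:
  fixes V :: "('l list \<Rightarrow>\<^sub>0 complex) set" and R :: "nat \<Rightarrow> 'l list \<Rightarrow>\<^sub>0 complex"
  assumes add: "\<And>p q. p \<in> V \<Longrightarrow> q \<in> V \<Longrightarrow> p + q \<in> V"
    and scale: "\<And>a p. p \<in> V \<Longrightarrow> const a * p \<in> V"
    and poly: "\<And>s. s \<noteq> 0 \<Longrightarrow> (\<Sum>i\<le>N. const (s ^ i) * R i) \<in> V"
    and "i \<le> N"
  shows "R i \<in> V"
  using poly \<open>i \<le> N\<close>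
proof (induction N arbitrary: R i)
  case 0
  from 0(1)[of 1] 0(2) show ?case by simp
next
  case (Suc N)
  let ?p = "\<lambda>s. \<Sum>i\<le>Suc N. const (s ^ i) * R i"
  have low: "R i \<in> V" if "i \<le> N" for i
  proof -
    let ?d = "\<lambda>i. 2 ^ i - 2 ^ Suc N :: complex"
    have vals: "(\<Sum>i\<le>N. const (s ^ i) * (const (?d i) * R i)) \<in> V" if "s \<noteq> 0" for s
    proof -
      have "?p (2 * s) + const (- (2 ^ Suc N)) * ?p s \<in> V"
        using Suc.prems(1)[of "2 * s"] Suc.prems(1)[of s] that by (intro add scale) auto
      also have "?p (2 * s) + const (- (2 ^ Suc N)) * ?p s =
          (\<Sum>i\<le>Suc N. const (s ^ i) * (const (?d i) * R i))"
        unfolding sum_distrib_left sum.distrib[symmetric]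
      proof (rule sum.cong[OF refl])
        fix i
        have "const ((2 * s) ^ i) * R i + const (- (2 ^ Suc N)) * (const (s ^ i) * R i) =
            const ((2 * s) ^ i + - (2 ^ Suc N) * s ^ i) * R i"
          by (simp only: const_simps distrib_right mult.assoc)
        also have "(2 * s) ^ i + - (2 ^ Suc N) * s ^ i = s ^ i * ?d i"
          by (simp add: power_mult_distrib algebra_simps)
        finally show "const ((2 * s) ^ i) * R i + const (- (2 ^ Suc N)) * (const (s ^ i) * R i) =
            const (s ^ i) * (const (?d i) * R i)"
          by (simp only: const_simps mult.assoc)
      qed
      also have "\<dots> = (\<Sum>i\<le>N. const (s ^ i) * (const (?d i) * R i))" by simp
      finally show ?thesis .
    qed
    have m: "const (inverse (?d i)) * (const (?d i) * R i) \<in> V"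
      by (rule scale, rule Suc.IH[of "\<lambda>i. const (?d i) * R i"]) (use vals that in auto)
    have "(2::nat) ^ i < 2 ^ Suc N" using that by (intro power_strict_increasing) auto
    then have "(of_nat (2 ^ i) :: complex) \<noteq> of_nat (2 ^ Suc N)" by (simp only: of_nat_eq_iff)
    then have "?d i \<noteq> 0" by simp
    then show ?thesis using m by (simp only: const_inverse_cancel not_False_eq_True)
  qed
  show ?case
  proof (cases "i \<le> N")
    case False
    then have i: "i = Suc N" using Suc.prems(2) by simp
    have "0 \<in> V" using scale[OF low[of 0], of 0] by simp
    then have "(\<Sum>i\<le>N. R i) \<in> V" using low by (intro span_sum_mem add) auto
    then have "?p 1 + const (- 1) * (\<Sum>i\<le>N. R i) \<in> V"
      using Suc.prems(1)[of 1] by (intro add scale) auto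
    then show ?thesis unfolding i by simp
  qed (rule low)
qed

text \<open>Together with \<open>algebra_simps\<close> these rules give a normal form in which all scalars stand in front of
the noncommutative monomials.\<close>

lemma const_left_commute: "const a * (const b * p) = const b * (const a * p)"
  by (metis const_commute mult.assoc)
lemma const_pull: "NO_MATCH (const b) p \<Longrightarrow> p * (const a * q) = const a * (p * q)"
  by (metis const_commute mult.assoc)
lemma const_pull': "NO_MATCH (const b) p \<Longrightarrow> p * const a = const a * p"
  by (rule const_commute[symmetric])
lemmas free_algebra_simps = algebra_simps const_left_commute const_pull const_pull'

section \<open>Calculus modulo the defining ideal\<close>

locale cherednik =
  fixes W :: "(real^'n \<Rightarrow> real^'n) set"
    and \<alpha> :: "(real^'n \<Rightarrow> real^'n) \<Rightarrow> complex^'n \<Rightarrow> complex"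
    and \<alpha>v :: "(real^'n \<Rightarrow> real^'n) \<Rightarrow> complex^'n"
    and t :: complex and c :: "(real^'n \<Rightarrow> real^'n) \<Rightarrow> complex"
  assumes W: "finite_reflection_group W" and R: "root_data W \<alpha> \<alpha>v"
begin

abbreviation F :: "'n free set" where "F \<equiv> carrier (free_algebra (letters W))"
abbreviation I :: "'n free set" where "I \<equiv> cherednik_ideal W \<alpha> \<alpha>v t c"

lemmas I_ideal = CI[OF W R, of t c]
lemmas I_F = id_carr[OF I_ideal]
lemmas I_0 = id_0[OF I_ideal]
lemmas I_add = id_add[OF I_ideal]
lemmas I_uminus = id_uminus[OF I_ideal]
lemmas I_diff = id_diff[OF I_ideal]
lemmas I_l = id_l[OF I_ideal]
lemmas I_r = id_r[OF I_ideal]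
lemmas I_const = id_c[OF I_ideal]
lemmas rels = CI_rels[OF W R, of _ _ t c]
lemmas letter_F = letter_carr[OF W]

definition eqv :: "'n free \<Rightarrow> 'n free \<Rightarrow> bool" (infix \<open>\<approxeq>\<close> 50) where
  "p \<approxeq> q \<longleftrightarrow> p - q \<in> I"

lemma eqv_refl [simp]: "p \<approxeq> p" by (simp add: eqv_def I_0)
lemma eqv_sym: "p \<approxeq> q \<Longrightarrow> q \<approxeq> p"
  using I_uminus[of "p - q"] by (simp add: eqv_def)
lemma eqv_trans [trans]: "p \<approxeq> q \<Longrightarrow> q \<approxeq> r \<Longrightarrow> p \<approxeq> r"
  using I_add[of "p - q" "q - r"] by (simp add: eqv_def)
lemma eq_eqv_trans [trans]: "p = q \<Longrightarrow> q \<approxeq> r \<Longrightarrow> p \<approxeq> r"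
  and eqv_eq_trans [trans]: "p \<approxeq> q \<Longrightarrow> q = r \<Longrightarrow> p \<approxeq> r"
  by simp_all
lemma eqv_add: "p \<approxeq> p' \<Longrightarrow> q \<approxeq> q' \<Longrightarrow> p + q \<approxeq> p' + q'"
  using I_add[of "p - p'" "q - q'"] by (simp add: eqv_def algebra_simps)
lemma eqv_diff: "p \<approxeq> p' \<Longrightarrow> q \<approxeq> q' \<Longrightarrow> p - q \<approxeq> p' - q'"
  using I_diff[of "p - p'" "q - q'"] by (simp add: eqv_def algebra_simps)
lemma eqv_l: "p \<approxeq> p' \<Longrightarrow> q \<in> F \<Longrightarrow> q * p \<approxeq> q * p'"
  using I_l[of "p - p'" q] by (simp add: eqv_def algebra_simps)
lemma eqv_r: "p \<approxeq> p' \<Longrightarrow> q \<in> F \<Longrightarrow> p * q \<approxeq> p' * q"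
  using I_r[of "p - p'" q] by (simp add: eqv_def algebra_simps)
lemma eqv_mult: "p \<approxeq> p' \<Longrightarrow> q \<approxeq> q' \<Longrightarrow> p' \<in> F \<Longrightarrow> q \<in> F \<Longrightarrow> p * q \<approxeq> p' * q'"
  by (rule eqv_trans[OF eqv_r eqv_l])
lemma eqv_const: "p \<approxeq> p' \<Longrightarrow> const a * p \<approxeq> const a * p'"
  by (rule eqv_l) (auto intro: fc)
lemma eqv_0: "p \<approxeq> 0 \<longleftrightarrow> p \<in> I" by (simp add: eqv_def)

text \<open>The letters of one row: the pairs \<open>(a, b)\<close> form the standard representation of \<open>SL\<^sub>2\<close>.\<close>

definition z :: "complex \<Rightarrow> complex \<Rightarrow> complex^'n \<Rightarrow> 'n free" where
  "z a b v = const a * gen (Vec v) + const b * gen (Cov (cform v))"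

definition word :: "complex \<Rightarrow> complex \<Rightarrow> (complex^'n) list \<Rightarrow> 'n free" where
  "word a b vs = prod_list (map (z a b) vs)"

lemma word_simps [simp]: "word a b [] = 1" "word a b (v # vs) = z a b v * word a b vs"
  "word a b (us @ vs) = word a b us * word a b vs"
  by (simp_all add: word_def)

lemma z_F [simp]: "z a b v \<in> F"
  unfolding z_def by (intro fc letter_F)
lemma word_F [simp]: "word a b vs \<in> F"
  by (induction vs) (auto intro: fc_mult fc_1)

abbreviation K :: "complex^'n \<Rightarrow> complex^'n \<Rightarrow> 'n free" where
  "K u v \<equiv> bracket W \<alpha> \<alpha>v t c u (cform v)"


lemma K_sym: "K u v = K v u" by (rule bracket_sym[OF W R])

definition momentum :: "complex^'n \<Rightarrow> complex^'n \<Rightarrow> 'n free" where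
  "momentum u v = gen (Cov (cform u)) * gen (Vec v) - gen (Cov (cform v)) * gen (Vec u)"

text \<open>By \<open>contraction_eqv\<close> this is minus the momentum, up to an element of the group algebra. It is the form
in which momenta arise from an exchange of rows without an error term.\<close>

definition contraction :: "complex^'n \<Rightarrow> complex^'n \<Rightarrow> 'n free" where
  "contraction u v = gen (Vec u) * gen (Cov (cform v)) - gen (Cov (cform u)) * gen (Vec v)"

lemma momentum_F [simp]: "momentum u v \<in> F" and contraction_F [simp]: "contraction u v \<in> F"
  unfolding momentum_def contraction_def by (intro fc letter_F)+

lemma contraction_eqv: "contraction u v \<approxeq> K u v - momentum u v"
proof -
  have "contraction u v - (K u v - momentum u v) = commutator (gen (Vec u)) (gen (Cov (cform v))) - K u v"
    by (simp add: contraction_def momentum_def commutator_def)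
  then show ?thesis using rels(9)[of u v] by (simp only: eqv_def)
qed

text \<open>An antisymmetric bilinear expression in two rows is a multiple of their determinant. This identity
holds already in the free algebra.\<close>

lemma exchange: "z a b u * z d e v - z d e u * z a b v = const (a * e - b * d) * contraction u v"
  by (simp add: z_def contraction_def free_algebra_simps)

text \<open>The symmetry of \<open>K\<close> makes the commutator of two letters depend on their rows only through the determinant.
In particular the letters of one row commute.\<close>

lemma commute_z:
  "commutator (z a b u) (z d e v) \<approxeq> const (a * e - b * d) * K u v"
proof -
  let ?P = "\<lambda>u v. commutator (gen (Vec u)) (gen (Cov (cform v)))"
  have "commutator (z a b u) (z d e v) =
     const (a * d) * commutator (gen (Vec u)) (gen (Vec v)) + const (a * e) * ?P u v +
     (const (- (b * d)) * ?P v u +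
     const (b * e) * commutator (gen (Cov (cform u))) (gen (Cov (cform v))))"
    by (simp add: z_def commutator_def free_algebra_simps)
  also have "\<dots> \<approxeq> const (a * d) * 0 + const (a * e) * K u v + (const (- (b * d)) * K v u + const (b * e) * 0)"
    using rels(7)[of u v] rels(8)[of u v] rels(9)[of u v] rels(9)[of v u]
    by (intro eqv_add eqv_const) (auto simp: eqv_def)
  also have "\<dots> = const (a * e - b * d) * K u v"
    by (simp add: K_sym[of v u] algebra_simps)
  finally show ?thesis .
qed

text \<open>The error terms again contain one letter of the row \<open>(a, b)\<close> and a group algebra element. This is what
allows momenta to be moved through a word without leaving the words of that row.\<close>

lemma contraction_z:
  "contraction u v * z a b w \<approxeq> z a b w * contraction u v + K w u * z a b v - z a b u * K w v"
proof -
  let ?L = "z a b w"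
  let ?y = "\<lambda>u. gen (Vec u) :: 'n free" and ?x = "\<lambda>u. gen (Cov (cform u)) :: 'n free"
  \<comment> \<open>The four commutators of \<open>?L\<close> with the letters of the contraction are known modulo the ideal.\<close>
  define y where "y u = commutator ?L (?y u) + const b * K w u" for u
  define x where "x u = commutator ?L (?x u) - const a * K w u" for u
  have y: "y u \<in> I" for u
    using commute_z[of a b w 1 0 u] by (simp add: eqv_def y_def z_def[of 1 0])
  have x: "x u \<in> I" for u
    using commute_z[of a b w 0 1 u] by (simp add: eqv_def x_def z_def[of 0 1])
  have "contraction u v * z a b w - (z a b w * contraction u v + K w u * z a b v - z a b u * K w v) =
    - (y u * ?x v + ?y u * x v - x u * ?y v - ?x u * y v)"
    unfolding x_def y_def commutator_def contraction_def z_def[of a b u] z_def[of a b v]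
    by (simp add: free_algebra_simps)
  moreover have "\<dots> \<in> I"
    by (intro I_uminus I_diff I_add I_l I_r x y letter_F)
  ultimately show ?thesis by (simp add: eqv_def)
qed

lemma grp_z: assumes "w \<in> W"
  shows "gen (Grp w) * z a b v \<approxeq> z a b (complexify w v) * gen (Grp w)"
proof -
  have "gen (Grp w) * z a b v - z a b (complexify w v) * gen (Grp w) =
    const a * (gen (Grp w) * gen (Vec v) - gen (Vec (complexify w v)) * gen (Grp w)) +
    const b * (gen (Grp w) * gen (Cov (cform v)) - gen (Cov (cform (complexify w v))) * gen (Grp w))"
    by (simp add: z_def free_algebra_simps)
  then show ?thesis using rels(5,6)[OF assms] by (auto simp: eqv_def intro!: I_add I_const)
qed

lemma grp_word: assumes "w \<in> W"
  shows "gen (Grp w) * word a b vs \<approxeq> word a b (map (complexify w) vs) * gen (Grp w)"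
proof (induction vs)
  case (Cons v vs)
  note G = letter_F(4)[OF assms]
  have "gen (Grp w) * word a b (v # vs) = (gen (Grp w) * z a b v) * word a b vs"
    by (simp add: mult.assoc)
  also have "\<dots> \<approxeq> (z a b (complexify w v) * gen (Grp w)) * word a b vs"
    by (intro eqv_r grp_z assms word_F)
  also have "\<dots> = z a b (complexify w v) * (gen (Grp w) * word a b vs)" by (simp add: mult.assoc)
  also have "\<dots> \<approxeq> z a b (complexify w v) * (word a b (map (complexify w) vs) * gen (Grp w))"
    by (intro eqv_l Cons.IH z_F)
  finally show ?case by (simp add: mult.assoc)
qed simp

text \<open>The preimage in the free algebra of the Dunkl angular momentum algebra. All complex vectors are allowed in the
momenta, so that no basis has to be carried along.\<close>

inductive_set angular :: "'n free set" where
  ideal: "p \<in> I \<Longrightarrow> p \<in> angular"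
| const: "const a \<in> angular"
| grp: "w \<in> W \<Longrightarrow> gen (Grp w) \<in> angular"
| momentum: "momentum u v \<in> angular"
| add: "p \<in> angular \<Longrightarrow> q \<in> angular \<Longrightarrow> p + q \<in> angular"
| mult: "p \<in> angular \<Longrightarrow> q \<in> angular \<Longrightarrow> p * q \<in> angular"

lemma angular_F: "p \<in> angular \<Longrightarrow> p \<in> F"
  by (induction rule: angular.induct) (auto intro: I_F fc letter_F)

lemma angular_uminus: "p \<in> angular \<Longrightarrow> - p \<in> angular"
  using angular.mult[OF angular.const[of "- 1"]] by simp
lemma angular_diff: "p \<in> angular \<Longrightarrow> q \<in> angular \<Longrightarrow> p - q \<in> angular"
  using angular.add[of p "- q"] angular_uminus[of q] by simp
lemma angular_eqv: "p \<approxeq> q \<Longrightarrow> q \<in> angular \<Longrightarrow> p \<in> angular"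
  using angular.add[OF angular.ideal[of "p - q"], of q] by (simp add: eqv_def)
lemma angular_sum: "(\<And>i. i \<in> A \<Longrightarrow> f i \<in> angular) \<Longrightarrow> sum f A \<in> angular"
  by (rule span_sum_mem) (auto intro: angular.intros I_0)
lemma angular_K: "K u v \<in> angular"
  unfolding bracket_def[OF W] by (intro angular_diff angular_sum angular.const angular.mult angular.grp) (auto simp: reflections_in_def)
lemma angular_contraction: "contraction u v \<in> angular"
  by (rule angular_eqv[OF contraction_eqv]) (intro angular_diff angular_K angular.momentum)

text \<open>The right module over the angular elements that is spanned by \<open>X\<close>, together with the ideal. With the
coefficients on the right, the span of the words will be closed under multiplication by letters from the left.\<close>

inductive_set right_span :: "'n free set \<Rightarrow> 'n free set" for X where
  ideal: "p \<in> I \<Longrightarrow> p \<in> right_span X"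
| base: "p \<in> X \<Longrightarrow> q \<in> angular \<Longrightarrow> p * q \<in> right_span X"
| add: "p \<in> right_span X \<Longrightarrow> q \<in> right_span X \<Longrightarrow> p + q \<in> right_span X"

lemma right_span_r: "p \<in> right_span X \<Longrightarrow> q \<in> angular \<Longrightarrow> p * q \<in> right_span X"
proof (induction rule: right_span.induct)
  case (base p r)
  then show ?case using right_span.base[of p X "r * q"] by (simp add: mult.assoc angular.mult)
qed (auto simp: distrib_right intro: right_span.intros I_r angular_F)
lemma right_span_const: "p \<in> right_span X \<Longrightarrow> const a * p \<in> right_span X"
  unfolding const_commute by (rule right_span_r[OF _ angular.const])
lemma right_span_gen: "p \<in> X \<Longrightarrow> p \<in> right_span X"
  using right_span.base[of p X 1] angular.const[of 1] by simp
lemma right_span_0: "0 \<in> right_span X" by (rule right_span.ideal[OF I_0])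
lemma right_span_diff: "p \<in> right_span X \<Longrightarrow> q \<in> right_span X \<Longrightarrow> p - q \<in> right_span X"
  using right_span.add[of p X "const (- 1) * q"] right_span_const[of q X "- 1"] by simp
lemma right_span_sum: "(\<And>i. i \<in> A \<Longrightarrow> f i \<in> right_span X) \<Longrightarrow> sum f A \<in> right_span X"
  by (rule span_sum_mem) (auto intro: right_span.add right_span_0)
lemma right_span_eqv: "p \<approxeq> q \<Longrightarrow> q \<in> right_span X \<Longrightarrow> p \<in> right_span X"
  using right_span.add[OF right_span.ideal[of "p - q"], of q] by (simp add: eqv_def)
lemma right_span_subset:
  assumes "X \<subseteq> right_span Y" shows "right_span X \<subseteq> right_span Y"
proof
  fix p assume "p \<in> right_span X"
  then show "p \<in> right_span Y"
    by induction (use assms in \<open>auto intro: right_span.ideal right_span.add right_span_r\<close>)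
qed

section \<open>Words with a single row span the algebra\<close>

definition words :: "'n free set" where "words = {word a b vs | a b vs. True}"

lemma word_in_words [simp]: "word a b vs \<in> words" by (auto simp: words_def)

lemma word_in_right_span: "q \<in> angular \<Longrightarrow> word a b vs * q \<in> right_span words"
  by (rule right_span.base) simp

text \<open>A group element that stands inside a word can be moved to its right end, because the group permutes the words of
one row.\<close>

lemma word_grp_word:
  assumes w: "w \<in> W" and q: "q \<in> angular"
  shows "word a b us * (gen (Grp w) * (word a b vs * q)) \<in> right_span words"
proof (rule right_span_eqv)
  have "word a b us * (gen (Grp w) * (word a b vs * q)) = word a b us * ((gen (Grp w) * word a b vs) * q)"
    by (simp add: mult.assoc)
  also have "\<dots> \<approxeq> word a b us * ((word a b (map (complexify w) vs) * gen (Grp w)) * q)"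
    by (intro eqv_l eqv_r grp_word w word_F angular_F q)
  also have "\<dots> = word a b (us @ map (complexify w) vs) * (gen (Grp w) * q)"
    by (simp add: mult.assoc)
  finally show "word a b us * (gen (Grp w) * (word a b vs * q)) \<approxeq> word a b (us @ map (complexify w) vs) * (gen (Grp w) * q)" .
  show "word a b (us @ map (complexify w) vs) * (gen (Grp w) * q) \<in> right_span words"
    by (intro word_in_right_span angular.mult angular.grp w q)
qed

lemma word_K_word:
  assumes q: "q \<in> angular"
  shows "word a b us * (K u v * (word a b vs * q)) \<in> right_span words"
proof -
  have c: "word a b us * (const k * (word a b vs * q)) \<in> right_span words" for k
  proof -
    have "word a b us * (const k * (word a b vs * q)) = const k * (word a b (us @ vs) * q)"
      by (simp add: mult.assoc const_pull)
    then show ?thesis by (simp only:) (intro right_span_const word_in_right_span q)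
  qed
  have g: "word a b us * (const k * gen (Grp s) * (word a b vs * q)) \<in> right_span words" if "s \<in> W" for k s
  proof -
    have "word a b us * (const k * gen (Grp s) * (word a b vs * q)) = const k * (word a b us * (gen (Grp s) * (word a b vs * q)))"
      by (simp add: mult.assoc const_pull)
    then show ?thesis by (simp only:) (intro right_span_const word_grp_word q that)
  qed
  show ?thesis
    unfolding bracket_def[OF W] left_diff_distrib right_diff_distrib sum_distrib_left sum_distrib_right
    by (intro right_span_diff right_span_sum c g) (auto simp: reflections_in_def)
qed

text \<open>The contraction is moved to the right. Each letter that it passes leaves error terms of the same row with a
group algebra element in the middle, which lie in the span by \<open>word_K_word\<close>.\<close>

lemma word_contraction_word:
  assumes q: "q \<in> angular"
  shows "word a b us * (contraction u v * (word a b vs * q)) \<in> right_span words"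
proof (induction vs arbitrary: us)
  case Nil
  show ?case using word_in_right_span[OF angular.mult[OF angular_contraction q], of a b us u v] by simp
next
  case (Cons w vs)
  let ?V = "word a b vs * q" and ?U = "word a b us"
  have F: "?V \<in> F" by (intro fc_mult word_F angular_F q)
  have "?U * (contraction u v * (word a b (w # vs) * q)) = ?U * ((contraction u v * z a b w) * ?V)"
    by (simp add: mult.assoc)
  also have "\<dots> \<approxeq> ?U * ((z a b w * contraction u v + K w u * z a b v - z a b u * K w v) * ?V)"
    by (intro eqv_l eqv_r contraction_z F word_F)
  also have "\<dots> = word a b (us @ [w]) * (contraction u v * ?V) +
      ?U * (K w u * (word a b (v # vs) * q)) - word a b (us @ [u]) * (K w v * ?V)"
    by (simp add: algebra_simps)
  finally show ?case
    by (rule right_span_eqv) (intro right_span_diff right_span.add Cons.IH word_K_word q)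
qed

text \<open>The derivative of \<open>word a b vs\<close> in the direction \<open>(d, e)\<close>: the sum of the words in which one letter
has its row replaced.\<close>

fun polarization :: "complex \<Rightarrow> complex \<Rightarrow> complex \<Rightarrow> complex \<Rightarrow> (complex^'n) list \<Rightarrow> 'n free" where
  "polarization a b d e [] = 0"
| "polarization a b d e (v # vs) = z d e v * word a b vs + z a b v * polarization a b d e vs"

text \<open>This is the Taylor expansion along a line. The vanishing above the length is there to make the induction
go through.\<close>

lemma word_line_expansion:
  "\<exists>R. R 0 = word a b vs \<and> R 1 = polarization a b d e vs \<and> (\<forall>i>length vs. R i = 0) \<and>
     (\<forall>s. word (a + s * d) (b + s * e) vs = (\<Sum>i\<le>length vs. const (s ^ i) * R i))"
proof (induction vs)
  case Nil
  show ?case by (rule exI[of _ "\<lambda>i. if i = 0 then 1 else 0"]) auto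
next
  case (Cons v vs)
  then obtain R where R: "R 0 = word a b vs" "R 1 = polarization a b d e vs" "\<And>i. i > length vs \<Longrightarrow> R i = 0"
    "\<And>s. word (a + s * d) (b + s * e) vs = (\<Sum>i\<le>length vs. const (s ^ i) * R i)"
    by blast
  \<comment> \<open>The coefficients of the product with the linear factor \<open>z a b v + s z d e v\<close>.\<close>
  let ?R = "\<lambda>i. z a b v * R i + (if i = 0 then 0 else z d e v * R (i - 1))"
  have "word (a + s * d) (b + s * e) (v # vs) = (\<Sum>i\<le>Suc (length vs). const (s ^ i) * ?R i)" for s
  proof -
    have zs: "z (a + s * d) (b + s * e) v = z a b v + const s * z d e v"
      by (simp add: z_def algebra_simps const_left_commute)
    have "(\<Sum>i\<le>Suc (length vs). const (s ^ i) * ?R i) =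
        (\<Sum>i\<le>Suc (length vs). const (s ^ i) * (z a b v * R i)) +
        (\<Sum>i\<le>Suc (length vs). const (s ^ i) * (if i = 0 then 0 else z d e v * R (i - 1)))"
      by (simp only: distrib_left sum.distrib)
    also have "(\<Sum>i\<le>Suc (length vs). const (s ^ i) * (z a b v * R i)) = z a b v * word (a + s * d) (b + s * e) vs"
      using R(3)[of "Suc (length vs)"]
      by (simp add: R(4) sum_distrib_left const_pull)
    also have "(\<Sum>i\<le>Suc (length vs). const (s ^ i) * (if i = 0 then 0 else z d e v * R (i - 1))) =
        const s * (z d e v * word (a + s * d) (b + s * e) vs)"
      unfolding sum.atMost_Suc_shift
      by (simp add: R(4) sum_distrib_left const_pull mult.assoc)
    finally show ?thesis by (simp add: zs distrib_right mult.assoc)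
  qed
  then show ?case using R by (intro exI[of _ ?R]) auto
qed

text \<open>The words on the line through \<open>(a, b)\<close> in the direction \<open>(d, e)\<close> all lie in the span, hence so does the
linear coefficient.\<close>

lemma polarization_in_right_span: "polarization a b d e vs \<in> right_span words"
proof (cases vs)
  case Nil then show ?thesis by (simp add: right_span_0)
next
  case (Cons v us)
  obtain R where R: "R 1 = polarization a b d e vs"
    "\<And>s. word (a + s * d) (b + s * e) vs = (\<Sum>i\<le>length vs. const (s ^ i) * R i)"
    using word_line_expansion[of a b vs d e] by blast
  have "(\<Sum>i\<le>length vs. const (s ^ i) * R i) \<in> right_span words" for s
    unfolding R(2)[symmetric] by (rule right_span_gen) simp
  then have "R 1 \<in> right_span words"
    by (rule polynomial_coefficients_in_subspace[where N="length vs", rotated 2])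
      (auto simp: Cons intro: right_span.add right_span_const)
  then show ?thesis by (simp only: R(1))
qed

text \<open>Moving the exceptional row one position to the left changes a word only by a contraction inside a
word. So every summand of the polarization can be replaced by the word in which the letter \<open>v\<close> in front is the
exceptional one.\<close>

lemma polarization_eq_first:
  "word a b us * z a b v * polarization a b d e vs
     - const (of_nat (length vs)) * (word a b us * z d e v * word a b vs) \<in> right_span words"
proof (induction vs arbitrary: us v)
  case Nil show ?case by (simp add: right_span_0)
next
  case (Cons w vs)
  let ?U = "word a b us" and ?V = "word a b vs" and ?n = "of_nat (length vs) :: complex"
  \<comment> \<open>The exceptional row moves from \<open>w\<close> to the letter \<open>v\<close> in front of it.\<close>
  have swap: "?U * z a b v * z d e w * ?V - ?U * z d e v * z a b w * ?V \<in> right_span words"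
  proof -
    have "?U * z a b v * z d e w * ?V - ?U * z d e v * z a b w * ?V =
        ?U * (z a b v * z d e w - z d e v * z a b w) * ?V"
      by (simp add: algebra_simps)
    also have "\<dots> = const (a * e - b * d) * (?U * (contraction v w * (?V * 1)))"
      unfolding exchange by (simp add: mult.assoc const_pull del: const_simps)
    finally show ?thesis
      using angular.const[of 1] by (simp only:) (intro right_span_const word_contraction_word, simp)
  qed
  have "?U * z a b v * polarization a b d e (w # vs) - const (of_nat (length (w # vs))) * (?U * z d e v * word a b (w # vs)) =
     (word a b (us @ [v]) * z a b w * polarization a b d e vs - const ?n * (word a b (us @ [v]) * z d e w * ?V)) +
     const (1 + ?n) * (?U * z a b v * z d e w * ?V - ?U * z d e v * z a b w * ?V)"
    by (simp add: algebra_simps)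
  also have "\<dots> \<in> right_span words" by (intro right_span.add right_span_const swap Cons.IH)
  finally show ?case .
qed

text \<open>The polarization of \<open>v # vs\<close> is congruent to \<open>1 + length vs\<close> times the given product, and lies in the span.\<close>

lemma z_word_in_right_span: "z d e v * word a b vs \<in> right_span words"
proof -
  let ?n = "of_nat (length vs) :: complex"
  have "polarization a b d e (v # vs) - (word a b [] * z a b v * polarization a b d e vs
     - const ?n * (word a b [] * z d e v * word a b vs)) \<in> right_span words"
    by (intro right_span_diff polarization_in_right_span polarization_eq_first)
  also have "polarization a b d e (v # vs) - (word a b [] * z a b v * polarization a b d e vs
     - const ?n * (word a b [] * z d e v * word a b vs)) = const (1 + ?n) * (z d e v * word a b vs)"
    by (simp add: algebra_simps)
  finally have "const (inverse (1 + ?n)) * (const (1 + ?n) * (z d e v * word a b vs)) \<in> right_span words"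
    by (rule right_span_const)
  moreover have "1 + ?n \<noteq> 0"
    by (metis of_nat_Suc of_nat_eq_0_iff nat.distinct(1))
  ultimately show ?thesis by (simp only: const_inverse_cancel not_False_eq_True)
qed

lemma z_right_span: "p \<in> right_span words \<Longrightarrow> z d e v * p \<in> right_span words"
proof (induction rule: right_span.induct)
  case (base p q)
  then obtain a b vs where "p = word a b vs" by (auto simp: words_def)
  then show ?case using right_span_r[OF z_word_in_right_span base(2), of d e v a b vs] by (simp add: mult.assoc)
next
  case (ideal p)
  then show ?case by (intro right_span.ideal I_l z_F)
next
  case (add p q)
  then show ?case unfolding distrib_left by (intro right_span.add)
qed

lemma grp_right_span: "p \<in> right_span words \<Longrightarrow> w \<in> W \<Longrightarrow> gen (Grp w) * p \<in> right_span words"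
proof (induction rule: right_span.induct)
  case (base p q)
  then obtain a b vs where "p = word a b vs" by (auto simp: words_def)
  then show ?case using word_grp_word[OF base(3,2), of a b "[]" vs] by simp
next
  case (ideal p)
  then show ?case by (intro right_span.ideal I_l letter_F)
next
  case (add p q)
  then show ?case unfolding distrib_left by (intro right_span.add)
qed

lemma letter_right_span:
  assumes "l \<in> letters W" "p \<in> right_span words"
  shows "gen l * p \<in> right_span words"
proof -
  consider v where "l = Vec v" | f where "l = Cov f" "clinear_functional f" | w where "l = Grp w" "w \<in> W"
    using assms(1) unfolding letters_def by blast
  then show ?thesis
  proof cases
    case (1 v)
    then show ?thesis using z_right_span[OF assms(2), of 1 0 v] by (simp add: z_def)
  next
    case (2 f)
    obtain u where "f = cform u" using clf_E[OF 2(2)] .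
    then show ?thesis using z_right_span[OF assms(2), of 0 1 u] by (simp add: z_def 2)
  next
    case (3 w)
    then show ?thesis using grp_right_span[OF assms(2)] by simp
  qed
qed

lemma all_in_right_span_words:
  assumes "p \<in> F"
  shows "p \<in> right_span words"
proof -
  have w: "set u \<subseteq> letters W \<Longrightarrow> prod_list (map gen u) \<in> right_span words" for u
  proof (induction u)
    case Nil
    have "word 0 0 [] \<in> right_span words" by (intro right_span_gen word_in_words)
    then show ?case by simp
  qed (auto intro: letter_right_span)
  have "p = subst gen p" by (rule subst_id[symmetric, OF _ assms]) simp
  also have "\<dots> \<in> right_span words"
    unfolding subst_def
    by (intro right_span_sum right_span_const w) (use assms in \<open>auto simp: free_carrier\<close>)
  finally show ?thesis .
qed

section \<open>The special linear group acting on words\<close>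

lemma act_F: "p \<in> F \<Longrightarrow> subst (act g) p \<in> F"
  by (rule fc_subst[OF act_carr[OF W R]])

lemma act_I:
  assumes "det g = 1" "p \<in> I" shows "subst (act g) p \<in> I"
  using subst_Idl[OF rels_carr[OF W] act_carr[OF W R] act_rel[OF W R assms(1), unfolded cherednik_ideal_def]]
    assms(2) unfolding cherednik_ideal_def by blast


lemma act_z: "subst (act g) (z a b v) = z (a * g$1$1 + b * g$2$1) (a * g$1$2 + b * g$2$2) v"
  by (simp add: z_def subst_simps act_def[OF W R] algebra_simps)

lemma act_word: "subst (act g) (word a b vs) = word (a * g$1$1 + b * g$2$1) (a * g$1$2 + b * g$2$2) vs"
  by (induction vs) (simp_all add: subst_1 subst_mult act_z)

text \<open>Modulo group algebra elements, the momentum is antisymmetric in the rows of its two letters, so it is multiplied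
by the determinant. The group algebra terms of \<open>exchange\<close> and of the reordering cancel.\<close>

lemma act_momentum:
  assumes "det g = 1"
  shows "subst (act g) (momentum u v) \<approxeq> momentum u v"
proof -
  let ?a = "g$1$1" and ?b = "g$1$2" and ?c = "g$2$1" and ?d = "g$2$2"
  have det: "?b * ?c - ?a * ?d = - 1" using assms by (simp add: det_2 algebra_simps)
  have "momentum u v = z 0 1 u * z 1 0 v - z 0 1 v * z 1 0 u"
    by (simp add: momentum_def z_def)
  then have "subst (act g) (momentum u v) = z ?c ?d u * z ?a ?b v - z ?c ?d v * z ?a ?b u"
    by (simp add: subst_simps act_z)
  \<comment> \<open>The letters of the second product are put in the order that \<open>exchange\<close> needs.\<close>
  also have "\<dots> = (z ?c ?d u * z ?a ?b v - z ?a ?b u * z ?c ?d v) + commutator (z ?a ?b u) (z ?c ?d v)"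
    by (simp add: commutator_def)
  also have "\<dots> \<approxeq> const (?c * ?b - ?d * ?a) * (K u v - momentum u v) + const (?a * ?d - ?b * ?c) * K u v"
    unfolding exchange by (intro eqv_add eqv_const contraction_eqv commute_z)
  also have "\<dots> = const (?b * ?c - ?a * ?d) * (- momentum u v)"
    by (simp add: algebra_simps)
  also have "\<dots> = momentum u v" by (simp only: det) simp
  finally show ?thesis .
qed

lemma act_grp: "subst (act g) (gen (Grp w)) = gen (Grp w)" for w :: "real^'n \<Rightarrow> real^'n"
  by (simp add: subst_gen act_def[OF W R])

lemma act_angular:
  assumes g: "det g = 1" and "q \<in> angular"
  shows "subst (act g) q \<approxeq> q"
  using assms(2)
proof (induction rule: angular.induct)
  case (ideal p)
  then show ?case using act_I[OF g] by (simp add: eqv_def I_diff)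
next
  case (mult p q)
  then show ?case unfolding subst_mult by (intro eqv_mult act_F angular_F)
qed (simp_all add: act_grp subst_const subst_add act_momentum[OF g] eqv_add)

text \<open>The coefficient of \<open>a\<^sup>m\<close> in \<open>word a b vs\<close>: the sum, over all choices of \<open>m\<close> positions, of the word
with vectors there and covectors elsewhere. For fixed \<open>vs\<close> these elements are the image of a weight basis
of \<open>Sym\<^sup>d \<complex>\<^sup>2\<close> with \<open>d = length vs\<close>, and \<open>m\<close> determines the weight.\<close>

fun mixed :: "nat \<Rightarrow> (complex^'n) list \<Rightarrow> 'n free" where
  "mixed m [] = (if m = 0 then 1 else 0)"
| "mixed m (v # vs) = z 0 1 v * mixed m vs + (if m = 0 then 0 else z 1 0 v * mixed (m - 1) vs)"

lemma mixed_F [simp]: "mixed m vs \<in> F"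
  by (induction vs arbitrary: m) (auto intro!: fc_add fc_mult fc_0 fc_1)

lemma mixed_eq_0: "length vs < m \<Longrightarrow> mixed m vs = 0"
  by (induction vs arbitrary: m) auto

lemma word_eq_sum_mixed:
  "word a b vs = (\<Sum>m\<le>length vs. const (a ^ m * b ^ (length vs - m)) * mixed m vs)"
proof (induction vs)
  case (Cons v vs)
  let ?n = "length vs" let ?c = "\<lambda>m. const (a ^ m * b ^ (Suc ?n - m)) :: 'n free"
  have z: "z a b v = const b * z 0 1 v + const a * z 1 0 v" by (simp add: z_def)
  have 1: "(\<Sum>m\<le>Suc ?n. ?c m * (z 0 1 v * mixed m vs)) = const b * z 0 1 v * word a b vs"
    by (simp add: mixed_eq_0 Cons.IH sum_distrib_left const_pull const_left_commute Suc_diff_le mult.assoc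
        del: const_simps(2)) (simp add: mult.assoc const_left_commute)
  have 2: "(\<Sum>m\<le>Suc ?n. ?c m * (if m = 0 then 0 else z 1 0 v * mixed (m - 1) vs)) = const a * z 1 0 v * word a b vs"
    unfolding sum.atMost_Suc_shift
    by (simp add: Cons.IH sum_distrib_left const_pull mult.assoc)
  have "(\<Sum>m\<le>Suc ?n. ?c m * mixed m (v # vs)) = (\<Sum>m\<le>Suc ?n. ?c m * (z 0 1 v * mixed m vs)) +
     (\<Sum>m\<le>Suc ?n. ?c m * (if m = 0 then 0 else z 1 0 v * mixed (m - 1) vs))"
    by (simp only: mixed.simps distrib_left sum.distrib)
  also have "\<dots> = word a b (v # vs)" unfolding 1 2 by (simp add: z distrib_right mult.assoc)
  finally show ?case by simp
qed simp

lemma mixed_0: "mixed 0 vs = word 0 1 vs"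
  by (induction vs) auto

definition torus :: "complex \<Rightarrow> complex^2^2" where
  "torus s = (\<chi> i j. if i = j then (if i = 1 then s else inverse s) else 0)"
definition upper :: "complex \<Rightarrow> complex^2^2" where
  "upper s = (\<chi> i j. if i = j then 1 else if i = 1 then s else 0)"
definition lower :: "complex \<Rightarrow> complex^2^2" where
  "lower s = (\<chi> i j. if i = j then 1 else if i = 1 then 0 else s)"

lemma det_sl2: "s \<noteq> 0 \<Longrightarrow> det (torus s) = 1" "det (upper s) = 1" "det (lower s) = 1"
  by (simp_all add: det_2 torus_def upper_def lower_def)

lemma torus_z: "subst (act (torus s)) (z a b v) = z (a * s) (b * inverse s) v"
  and upper_z: "subst (act (upper s)) (z a b v) = z a (a * s + b) v"
  by (simp_all add: act_z torus_def upper_def)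

text \<open>The weight is \<open>2 m - length vs\<close>; a power of \<open>s\<close> clears the denominators.\<close>

lemma torus_mixed:
  assumes s: "s \<noteq> 0"
  shows "const (s ^ length vs) * subst (act (torus s)) (mixed m vs) = const (s ^ (2 * m)) * mixed m vs"
proof (induction vs arbitrary: m)
  case Nil show ?case by (simp add: subst_simps)
next
  case (Cons v vs)
  let ?\<sigma> = "subst (act (torus s))" and ?S = "const (s ^ length vs) :: 'n free"
  have x: "?\<sigma> (z 0 1 v) = const (inverse s) * z 0 1 v" and y: "?\<sigma> (z 1 0 v) = const s * z 1 0 v"
    unfolding torus_z by (simp_all add: z_def)
  have xs: "const (s ^ Suc (length vs)) * (?\<sigma> (z 0 1 v) * p) = z 0 1 v * (?S * p)" for p
  proof -
    have "const (s ^ Suc (length vs)) * (?\<sigma> (z 0 1 v) * p) =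
        const (s ^ Suc (length vs) * inverse s) * (z 0 1 v * p)"
      unfolding x const_simps(2) by (simp only: mult.assoc)
    also have "s ^ Suc (length vs) * inverse s = s ^ length vs" using s by simp
    finally show ?thesis by (simp add: const_pull)
  qed
  have ys: "const (s ^ Suc (length vs)) * (?\<sigma> (z 1 0 v) * p) = const (s ^ 2) * (z 1 0 v * (?S * p))" for p
    unfolding y by (simp add: const_pull mult.assoc power2_eq_square const_left_commute)
  show ?case
  proof (cases m)
    case 0
    then show ?thesis using xs Cons.IH[of 0] by (simp add: subst_simps)
  next
    case (Suc k)
    have "const (s ^ length (v # vs)) * ?\<sigma> (mixed m (v # vs)) =
        z 0 1 v * (?S * ?\<sigma> (mixed m vs)) + const (s ^ 2) * (z 1 0 v * (?S * ?\<sigma> (mixed k vs)))"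
    proof -
      have "mixed m (v # vs) = z 0 1 v * mixed m vs + z 1 0 v * mixed k vs" by (simp add: Suc)
      then show ?thesis by (simp only: subst_add subst_mult distrib_left length_Cons xs ys)
    qed
    also have "\<dots> = const (s ^ (2 * m)) * (z 0 1 v * mixed m vs) + const (s ^ 2 * s ^ (2 * k)) * (z 1 0 v * mixed k vs)"
      unfolding Cons.IH by (simp add: const_pull mult.assoc del: power_mult)
    also have "s ^ 2 * s ^ (2 * k) = s ^ (2 * m)" by (simp add: Suc power_add[symmetric])
    finally show ?thesis by (simp add: Suc distrib_left)
  qed
qed

text \<open>Only the leading coefficient is made explicit: the highest possible power of \<open>s\<close> replaces all \<open>m\<close> vectors by
covectors, and each choice of positions contributes the same word.\<close>

lemma upper_mixed:
  "\<exists>R. R m = const (of_nat (length vs choose m)) * mixed 0 vs \<and> (\<forall>i>m. R i = 0) \<and>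
     (\<forall>s. subst (act (upper s)) (mixed m vs) = (\<Sum>i\<le>m. const (s ^ i) * R i))"
proof (induction vs arbitrary: m)
  case Nil
  show ?case
    by (rule exI[of _ "\<lambda>i. if m = 0 \<and> i = 0 then 1 else 0"]) (auto simp: subst_simps binomial_eq_0)
next
  case (Cons v vs)
  let ?\<sigma> = "\<lambda>s. subst (act (upper s))"
  obtain R where R: "R m = const (of_nat (length vs choose m)) * mixed 0 vs" "\<And>i. i > m \<Longrightarrow> R i = 0"
    "\<And>s. ?\<sigma> s (mixed m vs) = (\<Sum>i\<le>m. const (s ^ i) * R i)"
    using Cons.IH[of m] by blast
  show ?case
  proof (cases m)
    case 0
    then show ?thesis using R
      by (intro exI[of _ "\<lambda>i. z 0 1 v * R i"]) (auto simp: subst_simps upper_z)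
  next
    case (Suc k)
    obtain Q where Q: "Q k = const (of_nat (length vs choose k)) * mixed 0 vs" "\<And>i. i > k \<Longrightarrow> Q i = 0"
      "\<And>s. ?\<sigma> s (mixed k vs) = (\<Sum>i\<le>k. const (s ^ i) * Q i)"
      using Cons.IH[of k] by blast
    \<comment> \<open>For \<open>i = m\<close> the first and third summands combine by the recursion of Pascal, and the middle one vanishes.\<close>
    let ?Q = "\<lambda>i. z 0 1 v * R i + (z 1 0 v * Q i + (if i = 0 then 0 else z 0 1 v * Q (i - 1)))"
    have "?\<sigma> s (mixed m (v # vs)) = (\<Sum>i\<le>m. const (s ^ i) * ?Q i)" for s
    proof -
      have 1: "(\<Sum>i\<le>m. const (s ^ i) * (z 0 1 v * R i)) = z 0 1 v * ?\<sigma> s (mixed m vs)"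
        by (simp add: R(3) sum_distrib_left const_pull)
      have 2: "(\<Sum>i\<le>m. const (s ^ i) * (z 1 0 v * Q i)) = z 1 0 v * ?\<sigma> s (mixed k vs)"
        by (simp add: Suc Q sum_distrib_left const_pull)
      have 3: "(\<Sum>i\<le>m. const (s ^ i) * (if i = 0 then 0 else z 0 1 v * Q (i - 1))) =
          const s * (z 0 1 v * ?\<sigma> s (mixed k vs))"
        unfolding Suc sum.atMost_Suc_shift by (simp add: Q(3) sum_distrib_left const_pull mult.assoc)
      have z: "?\<sigma> s (z 1 0 v) = z 1 0 v + const s * z 0 1 v" "?\<sigma> s (z 0 1 v) = z 0 1 v"
        unfolding upper_z by (simp_all add: z_def)
      have "(\<Sum>i\<le>m. const (s ^ i) * ?Q i) = z 0 1 v * ?\<sigma> s (mixed m vs) +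
          (z 1 0 v * ?\<sigma> s (mixed k vs) + const s * (z 0 1 v * ?\<sigma> s (mixed k vs)))"
        unfolding 1[symmetric] 2[symmetric] 3[symmetric] by (simp only: distrib_left sum.distrib)
      then show ?thesis by (simp add: Suc subst_simps z distrib_right mult.assoc)
    qed
    moreover have "?Q m = const (of_nat (length (v # vs) choose m)) * mixed 0 (v # vs)"
      by (simp add: Suc R(1)[unfolded Suc] Q(1,2) const_pull distrib_right)
    ultimately show ?thesis using R(2) Q(2) by (intro exI[of _ ?Q]) (auto simp: Suc)
  qed
qed

lemma lower_mixed: "subst (act (lower s)) (mixed 0 vs) = (\<Sum>m\<le>length vs. const (s ^ m) * mixed m vs)"
proof -
  have "subst (act (lower s)) (word 0 1 vs) = word s 1 vs"
    by (simp add: act_word lower_def)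
  then show ?thesis by (simp add: mixed_0 word_eq_sum_mixed)
qed

section \<open>Invariants are angular\<close>

text \<open>Sums of \<open>mixed m vs * q\<close> in which the same terms are used for every \<open>m\<close>. Such a family is the image of one
equivariant map from \<open>Sym\<^sup>d \<complex>\<^sup>2\<close>, so information on the vector of index \<open>0\<close> carries over to all the
others.\<close>

inductive_set weight_family :: "nat \<Rightarrow> (nat \<Rightarrow> 'n free) set" for d where
  zero: "(\<lambda>m. 0) \<in> weight_family d"
| base: "length vs = d \<Longrightarrow> q \<in> angular \<Longrightarrow> (\<lambda>m. mixed m vs * q) \<in> weight_family d"
| add: "f \<in> weight_family d \<Longrightarrow> h \<in> weight_family d \<Longrightarrow> (\<lambda>m. f m + h m) \<in> weight_family d"

lemma upper_mixed_angular:
  assumes "q \<in> angular"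
  shows "\<exists>R. R m = const (of_nat (length vs choose m)) * (mixed 0 vs * q) \<and> (\<forall>i>m. R i = 0) \<and>
     (\<forall>s. subst (act (upper s)) (mixed m vs * q) \<approxeq> (\<Sum>i\<le>m. const (s ^ i) * R i))"
proof -
  obtain R where R: "R m = const (of_nat (length vs choose m)) * mixed 0 vs" "\<And>i. i > m \<Longrightarrow> R i = 0"
    "\<And>s. subst (act (upper s)) (mixed m vs) = (\<Sum>i\<le>m. const (s ^ i) * R i)"
    using upper_mixed[of m vs] by blast
  have "subst (act (upper s)) (mixed m vs * q) \<approxeq> (\<Sum>i\<le>m. const (s ^ i) * (R i * q))" for s
  proof -
    have "subst (act (upper s)) (mixed m vs * q) \<approxeq> subst (act (upper s)) (mixed m vs) * q"
      unfolding subst_mult by (intro eqv_l act_angular det_sl2 assms act_F mixed_F)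
    then show ?thesis by (simp add: R(3) sum_distrib_right mult.assoc)
  qed
  then show ?thesis using R by (intro exI[of _ "\<lambda>i. R i * q"]) (auto simp: mult.assoc)
qed

lemma weight_family_upper:
  assumes "f \<in> weight_family d"
  shows "\<exists>R. R m = const (of_nat (d choose m)) * f 0 \<and>
     (\<forall>s. subst (act (upper s)) (f m) \<approxeq> (\<Sum>i\<le>m. const (s ^ i) * R i))"
  using assms
proof (induction rule: weight_family.induct)
  case zero
  show ?case by (rule exI[of _ "\<lambda>i. 0"]) (simp add: subst_simps)
next
  case (base vs q)
  then show ?case using upper_mixed_angular[OF base(2), where m=m and vs=vs] by blast
next
  case (add f h)
  then obtain P Q where
    "P m = const (of_nat (d choose m)) * f 0" "\<And>s. subst (act (upper s)) (f m) \<approxeq> (\<Sum>i\<le>m. const (s ^ i) * P i)"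
    "Q m = const (of_nat (d choose m)) * h 0" "\<And>s. subst (act (upper s)) (h m) \<approxeq> (\<Sum>i\<le>m. const (s ^ i) * Q i)"
    by blast
  then show ?case
    by (intro exI[of _ "\<lambda>i. P i + Q i"]) (simp add: distrib_left sum.distrib subst_add eqv_add)
qed

text \<open>The vector of index \<open>0\<close> generates the family: its translates under the lower unipotent matrices have all
members as coefficients.\<close>

lemma weight_family_lower:
  assumes "f \<in> weight_family d"
  shows "subst (act (lower s)) (f 0) \<approxeq> (\<Sum>m\<le>d. const (s ^ m) * f m)"
  using assms
proof (induction rule: weight_family.induct)
  case (base vs q)
  have "subst (act (lower s)) (mixed 0 vs * q) \<approxeq> subst (act (lower s)) (mixed 0 vs) * q"
    unfolding subst_mult by (intro eqv_l act_angular det_sl2 base act_F mixed_F)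
  then show ?case by (simp add: lower_mixed base sum_distrib_right mult.assoc)
qed (simp_all add: subst_simps distrib_left sum.distrib eqv_add)

text \<open>The span of the zero weight vectors of length at most \<open>2 N\<close>.\<close>

definition balanced :: "nat \<Rightarrow> 'n free set" where
  "balanced N = right_span {mixed k vs | k vs. length vs = 2 * k \<and> k \<le> N}"

lemma balanced_0: "p \<in> balanced 0 \<Longrightarrow> p \<in> angular"
  unfolding balanced_def
proof (induction rule: right_span.induct)
  case (base p q) then show ?case by auto
qed (auto intro: angular.intros)

lemma balanced_upper:
  assumes "p \<in> balanced N"
  shows "\<exists>R. \<forall>s. subst (act (upper s)) p \<approxeq> (\<Sum>i\<le>N. const (s ^ i) * R i)"
  using assms unfolding balanced_def
proof (induction rule: right_span.induct)
  case (ideal p)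
  then show ?case by (intro exI[of _ "\<lambda>i. 0"]) (auto simp: eqv_0 act_I det_sl2)
next
  case (base p q)
  then obtain k vs where k: "p = mixed k vs" "k \<le> N" by blast
  obtain R where R: "\<And>i. i > k \<Longrightarrow> R i = 0"
    "\<And>s. subst (act (upper s)) (p * q) \<approxeq> (\<Sum>i\<le>k. const (s ^ i) * R i)"
    using upper_mixed_angular[OF base(2), of k vs] k by blast
  have "(\<Sum>i\<le>k. const (s ^ i) * R i) = (\<Sum>i\<le>N. const (s ^ i) * R i)" for s
    by (rule sum.mono_neutral_left) (use k R in auto)
  then show ?case using R(2) by auto
next
  case (add p q)
  then obtain P Q where "\<And>s. subst (act (upper s)) p \<approxeq> (\<Sum>i\<le>N. const (s ^ i) * P i)"
    "\<And>s. subst (act (upper s)) q \<approxeq> (\<Sum>i\<le>N. const (s ^ i) * Q i)"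
    by blast
  then show ?case
    by (intro exI[of _ "\<lambda>i. P i + Q i"]) (simp add: distrib_left sum.distrib subst_add eqv_add)
qed

text \<open>The terms of length \<open>2 N + 2\<close> are collected in a single family, because both unipotent subgroups have to
be applied to their sum.\<close>

lemma balanced_Suc:
  assumes "p \<in> balanced (Suc N)"
  shows "\<exists>p'\<in>balanced N. \<exists>f\<in>weight_family (2 * Suc N). p = p' + f (Suc N)"
  using assms unfolding balanced_def
proof (induction rule: right_span.induct)
  case (ideal p)
  then show ?case by (intro bexI[of _ p] bexI[of _ "\<lambda>m. 0"]) (auto intro: right_span.ideal weight_family.zero)
next
  case (base p q)
  then obtain k vs where k: "p = mixed k vs" "length vs = 2 * k" "k \<le> Suc N" by blast
  show ?case
  proof (cases "k \<le> N")
    case True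
    then show ?thesis using k base
      by (intro bexI[of _ "p * q"] bexI[of _ "\<lambda>m. 0"]) (auto intro!: right_span.base weight_family.zero)
  next
    case False
    then have "k = Suc N" using k by simp
    then show ?thesis using k base
      by (intro bexI[of _ 0] bexI[of _ "\<lambda>m. mixed m vs * q"]) (auto intro: right_span_0 weight_family.base)
  qed
next
  case (add p q)
  then obtain p' f q' h where
    "p' \<in> right_span {mixed k vs | k vs. length vs = 2 * k \<and> k \<le> N}" "f \<in> weight_family (2 * Suc N)" "p = p' + f (Suc N)"
    "q' \<in> right_span {mixed k vs | k vs. length vs = 2 * k \<and> k \<le> N}" "h \<in> weight_family (2 * Suc N)" "q = q' + h (Suc N)"
    by blast
  then show ?case
    by (intro bexI[of _ "p' + q'"] bexI[of _ "\<lambda>m. f m + h m"]) (auto intro: right_span.add weight_family.add)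
qed

lemma I_coefficients:
  assumes "\<And>s. s \<noteq> 0 \<Longrightarrow> (\<Sum>i\<le>N. const (s ^ i) * R i) \<in> I" "i \<le> N"
  shows "R i \<in> I"
  by (rule polynomial_coefficients_in_subspace[OF _ _ assms]) (auto intro: I_add I_const)

text \<open>Let \<open>f\<close> be the family of the terms of length \<open>2 N + 2\<close>. Under the upper unipotent matrices, the coefficient of
\<open>s\<close> in degree \<open>N + 1\<close> comes from \<open>f\<close> alone and is a nonzero multiple of \<open>f 0\<close>. It vanishes for an
invariant element, so \<open>f 0\<close> and then, by the lower unipotent matrices, \<open>f (N + 1)\<close> is zero modulo the ideal.\<close>

lemma balanced_invariant_in_angular:
  assumes inv: "\<And>g. det g = 1 \<Longrightarrow> subst (act g) p \<approxeq> p"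
  shows "p \<in> balanced N \<Longrightarrow> p \<in> angular"
proof (induction N)
  case 0 then show ?case by (rule balanced_0)
next
  case (Suc N)
  obtain p' f where p': "p' \<in> balanced N" and f: "f \<in> weight_family (2 * Suc N)" and p: "p = p' + f (Suc N)"
    using balanced_Suc[OF Suc.prems] by blast
  obtain P where P: "\<And>s. subst (act (upper s)) p' \<approxeq> (\<Sum>i\<le>N. const (s ^ i) * P i)"
    using balanced_upper[OF p'] by blast
  obtain Q where Q: "Q (Suc N) = const (of_nat (2 * Suc N choose Suc N)) * f 0"
     "\<And>s. subst (act (upper s)) (f (Suc N)) \<approxeq> (\<Sum>i\<le>Suc N. const (s ^ i) * Q i)"
    using weight_family_upper[OF f, of "Suc N"] by blast
  \<comment> \<open>The coefficients of the translate of \<open>p\<close> minus \<open>p\<close>.\<close>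
  let ?R = "\<lambda>i. (if i \<le> N then P i else 0) + Q i - (if i = 0 then p else 0)"
  have "(\<Sum>i\<le>Suc N. const (s ^ i) * ?R i) \<in> I" for s
  proof -
    have "(\<Sum>i\<le>Suc N. const (s ^ i) * ?R i) =
        (\<Sum>i\<le>Suc N. const (s ^ i) * (if i \<le> N then P i else 0)) + (\<Sum>i\<le>Suc N. const (s ^ i) * Q i) -
        (\<Sum>i\<le>Suc N. const (s ^ i) * (if i = 0 then p else 0))"
      by (simp only: distrib_left right_diff_distrib sum.distrib sum_subtractf)
    also have "(\<Sum>i\<le>Suc N. const (s ^ i) * (if i = 0 then p else 0)) = p"
      unfolding sum.atMost_Suc_shift by simp
    also have "(\<Sum>i\<le>Suc N. const (s ^ i) * (if i \<le> N then P i else 0)) = (\<Sum>i\<le>N. const (s ^ i) * P i)"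
      by simp
    also have "(\<Sum>i\<le>N. const (s ^ i) * P i) + (\<Sum>i\<le>Suc N. const (s ^ i) * Q i) - p \<approxeq>
        subst (act (upper s)) p' + subst (act (upper s)) (f (Suc N)) - subst (act (upper s)) p"
      by (intro eqv_diff eqv_add eqv_sym[OF P] eqv_sym[OF Q(2)] eqv_sym[OF inv] det_sl2(2))
    also have "\<dots> = 0" by (simp add: p subst_add)
    finally show ?thesis by (simp only: eqv_0)
  qed
  then have "?R (Suc N) \<in> I" by (rule I_coefficients) simp
  then have "const (of_nat (2 * Suc N choose Suc N)) * f 0 \<in> I" by (simp add: Q(1))
  then have "const (inverse (of_nat (2 * Suc N choose Suc N))) * (const (of_nat (2 * Suc N choose Suc N)) * f 0) \<in> I"
    by (rule I_const)
  moreover have "(of_nat (2 * Suc N choose Suc N) :: complex) \<noteq> 0"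
    by (simp only: of_nat_eq_0_iff) (simp add: binomial_eq_0_iff)
  ultimately have f0: "f 0 \<in> I" by (simp only: const_inverse_cancel not_False_eq_True)
  have "(\<Sum>m\<le>2 * Suc N. const (s ^ m) * f m) \<in> I" for s
    using eqv_trans[OF eqv_sym[OF weight_family_lower[OF f]], of s 0] act_I[OF det_sl2(3) f0]
    by (simp only: eqv_0)
  then have "f (Suc N) \<in> I" by (rule I_coefficients) simp
  then have "p \<approxeq> p'" by (simp add: p eqv_def)
  then have "p \<in> balanced N" using p' unfolding balanced_def by (rule right_span_eqv)
  then show ?case by (rule Suc.IH)
qed

definition mixed_words :: "'n free set" where "mixed_words = {mixed m vs | m vs. True}"

text \<open>The weights, shifted by \<open>N\<close>, become exponents of \<open>s\<close>, so the zero weight part is the coefficient in degree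
\<open>N\<close>. Every sufficiently large shift is allowed, since the two summands of a sum need a common one.\<close>

lemma torus_expansion:
  assumes "p \<in> right_span mixed_words"
  shows "\<exists>D. \<forall>N\<ge>D. \<exists>R. R N \<in> balanced N \<and>
    (\<forall>s. s \<noteq> 0 \<longrightarrow> const (s ^ N) * subst (act (torus s)) p \<approxeq> (\<Sum>i\<le>2 * N. const (s ^ i) * R i))"
  using assms
proof (induction rule: right_span.induct)
  case (ideal p)
  show ?case
    by (rule exI[of _ 0], intro allI impI exI[of _ "\<lambda>i. 0"])
      (auto simp: balanced_def eqv_0 right_span_0 intro!: I_const act_I ideal det_sl2)
next
  case (add p q)
  then obtain D E where
    D: "\<And>N. N \<ge> D \<Longrightarrow> \<exists>R. R N \<in> balanced N \<and> (\<forall>s. s \<noteq> 0 \<longrightarrow> const (s ^ N) * subst (act (torus s)) p \<approxeq> (\<Sum>i\<le>2 * N. const (s ^ i) * R i))" and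
    E: "\<And>N. N \<ge> E \<Longrightarrow> \<exists>R. R N \<in> balanced N \<and> (\<forall>s. s \<noteq> 0 \<longrightarrow> const (s ^ N) * subst (act (torus s)) q \<approxeq> (\<Sum>i\<le>2 * N. const (s ^ i) * R i))"
    by blast
  show ?case
  proof (intro exI[of _ "max D E"] allI impI)
    fix N assume N: "N \<ge> max D E"
    obtain P Q where "P N \<in> balanced N" "\<And>s. s \<noteq> 0 \<Longrightarrow> const (s ^ N) * subst (act (torus s)) p \<approxeq> (\<Sum>i\<le>2 * N. const (s ^ i) * P i)"
       "Q N \<in> balanced N" "\<And>s. s \<noteq> 0 \<Longrightarrow> const (s ^ N) * subst (act (torus s)) q \<approxeq> (\<Sum>i\<le>2 * N. const (s ^ i) * Q i)"
      using D[of N] E[of N] N by auto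
    then show "\<exists>R. R N \<in> balanced N \<and> (\<forall>s. s \<noteq> 0 \<longrightarrow> const (s ^ N) * subst (act (torus s)) (p + q) \<approxeq> (\<Sum>i\<le>2 * N. const (s ^ i) * R i))"
      by (intro exI[of _ "\<lambda>i. P i + Q i"])
        (simp add: distrib_left sum.distrib subst_add eqv_add balanced_def right_span.add)
  qed
next
  case (base p q)
  then obtain m vs where p: "p = mixed m vs" by (auto simp: mixed_words_def)
  show ?case
  proof (intro exI[of _ "length vs"] allI impI)
    fix N assume N: "N \<ge> length vs"
    let ?e = "N - length vs + 2 * m"
    let ?R = "\<lambda>i. if i = ?e \<and> m \<le> length vs then p * q else 0"
    have "?R N \<in> balanced N"
    proof (cases "N = ?e \<and> m \<le> length vs")
      case True
      then have "length vs = 2 * m" "m \<le> N" using N by auto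
      then have "p * q \<in> balanced N" unfolding balanced_def p by (intro right_span.base base(2)) blast
      then show ?thesis using True by simp
    qed (auto simp: balanced_def right_span_0)
    moreover have "const (s ^ N) * subst (act (torus s)) (p * q) \<approxeq> (\<Sum>i\<le>2 * N. const (s ^ i) * ?R i)"
      if s: "s \<noteq> 0" for s
    proof -
      have "s ^ N = s ^ (N - length vs) * s ^ length vs" using N by (simp add: power_add[symmetric])
      then have "const (s ^ N) * subst (act (torus s)) (p * q) =
          const (s ^ (N - length vs)) * (const (s ^ length vs) * subst (act (torus s)) p) * subst (act (torus s)) q"
        by (simp add: subst_mult mult.assoc)
      also have "\<dots> = const (s ^ ?e) * (p * subst (act (torus s)) q)"
        unfolding p torus_mixed[OF s] by (simp add: power_add mult.assoc)
      also have "\<dots> \<approxeq> const (s ^ ?e) * (p * q)"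
        by (intro eqv_const eqv_l act_angular det_sl2 s base) (simp add: p)
      also have "\<dots> = (\<Sum>i\<le>2 * N. const (s ^ i) * ?R i)"
      proof (cases "m \<le> length vs")
        case True
        then have "?e \<le> 2 * N" using N by simp
        then show ?thesis using True by (simp add: if_distrib cong: if_cong)
      next
        case False
        then show ?thesis by (simp add: p mixed_eq_0)
      qed
      finally show ?thesis .
    qed
    ultimately show "\<exists>R. R N \<in> balanced N \<and> (\<forall>s. s \<noteq> 0 \<longrightarrow> const (s ^ N) * subst (act (torus s)) (p * q) \<approxeq> (\<Sum>i\<le>2 * N. const (s ^ i) * R i))"
      by (intro exI[of _ ?R] conjI allI impI)
  qed
qed

lemma invariant_iff_angular:
  assumes "p \<in> F"
  shows "(\<forall>g. det g = 1 \<longrightarrow> subst (act g) p \<approxeq> p) \<longleftrightarrow> p \<in> angular"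
proof
  assume "p \<in> angular" then show "\<forall>g. det g = 1 \<longrightarrow> subst (act g) p \<approxeq> p" using act_angular by blast
next
  assume inv: "\<forall>g. det g = 1 \<longrightarrow> subst (act g) p \<approxeq> p"
  have "mixed m vs \<in> mixed_words" for m vs by (auto simp: mixed_words_def)
  then have "word a b vs \<in> right_span mixed_words" for a b vs
    unfolding word_eq_sum_mixed by (intro right_span_sum right_span_const) (rule right_span_gen)
  then have "words \<subseteq> right_span mixed_words" by (auto simp: words_def)
  then have "p \<in> right_span mixed_words" using right_span_subset all_in_right_span_words[OF assms] by blast
  then obtain N R where R: "R N \<in> balanced N"
     "\<And>s. s \<noteq> 0 \<Longrightarrow> const (s ^ N) * subst (act (torus s)) p \<approxeq> (\<Sum>i\<le>2 * N. const (s ^ i) * R i)"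
    using torus_expansion[of p] by blast
  \<comment> \<open>Invariance says that only the weight zero occurs, with coefficient \<open>p\<close>.\<close>
  let ?Q = "\<lambda>i. (if i = N then p else 0) - R i"
  have "(\<Sum>i\<le>2 * N. const (s ^ i) * ?Q i) \<in> I" if s: "s \<noteq> 0" for s
  proof -
    have "(\<Sum>i\<le>2 * N. const (s ^ i) * ?Q i) = const (s ^ N) * p - (\<Sum>i\<le>2 * N. const (s ^ i) * R i)"
      unfolding right_diff_distrib sum_subtractf by (simp add: if_distrib[of "(*) _"] cong: if_cong)
    moreover have "const (s ^ N) * p \<approxeq> (\<Sum>i\<le>2 * N. const (s ^ i) * R i)"
      by (rule eqv_trans[OF eqv_sym[OF eqv_const] R(2)[OF s]]) (use inv det_sl2(1)[OF s] in blast)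
    ultimately show ?thesis by (simp add: eqv_def)
  qed
  then have "?Q N \<in> I" by (intro I_coefficients[of ?Q "2 * N" N]) auto
  then have "p \<approxeq> R N" by (simp add: eqv_def)
  then have "p \<in> balanced N" using R(1) unfolding balanced_def by (rule right_span_eqv)
  then show "p \<in> angular" using balanced_invariant_in_angular inv by blast
qed

section \<open>Passage to the quotient\<close>

abbreviation H where "H \<equiv> cherednik_algebra W \<alpha> \<alpha>v t c"
abbreviation cls where "cls \<equiv> cherednik_class W \<alpha> \<alpha>v t c"

lemma cls_hom: "cls \<in> ring_hom (free_algebra (letters W)) H"
  using ideal.rcos_ring_hom[OF I_ideal] unfolding cherednik_algebra_def cherednik_class_def .

lemma H_ring: "ring H"
  unfolding cherednik_algebra_def by (rule ideal.quotient_is_ring[OF I_ideal])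

lemma cls_F: "p \<in> F \<Longrightarrow> cls p \<in> carrier H"
  by (rule ring_hom_closed[OF cls_hom])
lemma cls_add: "p \<in> F \<Longrightarrow> q \<in> F \<Longrightarrow> cls (p + q) = cls p \<oplus>\<^bsub>H\<^esub> cls q"
  using ring_hom_add[OF cls_hom] by simp
lemma cls_mult: "p \<in> F \<Longrightarrow> q \<in> F \<Longrightarrow> cls (p * q) = cls p \<otimes>\<^bsub>H\<^esub> cls q"
  using ring_hom_mult[OF cls_hom] by simp
lemma cls_1: "cls 1 = \<one>\<^bsub>H\<^esub>"
  using ring_hom_one[OF cls_hom] by simp
lemma cls_uminus: assumes "p \<in> F" shows "cls (- p) = \<ominus>\<^bsub>H\<^esub> cls p"
proof -
  interpret h: ring_hom_ring "free_algebra (letters W)" H cls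
    by (rule ring_hom_ringI2[OF ring_free H_ring cls_hom])
  show ?thesis using h.hom_a_inv[OF assms] by (simp only: free_a_inv[OF assms])
qed

lemma cls_eqv: "p \<in> F \<Longrightarrow> q \<in> F \<Longrightarrow> cls p = cls q \<longleftrightarrow> p \<approxeq> q"
  unfolding cherednik_class_def eqv_def by (rule cls_eq[OF I_ideal])

lemma cls_surj: "X \<in> carrier H \<Longrightarrow> \<exists>p\<in>F. X = cls p"
  by (auto simp: FactRing_def A_RCOSETS_def' cherednik_algebra_def cherednik_class_def)

text \<open>An automorphism is determined by its values on letters and scalars, so it is the one induced by \<open>act g\<close>.\<close>

lemma sl2_automorphism_cls:
  assumes \<phi>: "sl2_automorphism W \<alpha> \<alpha>v t c g \<phi>" and p: "p \<in> F"
  shows "\<phi> (cls p) = cls (subst (act g) p)"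
proof -
  note \<phi>' = \<phi>[unfolded sl2_automorphism_def Let_def]
  have hom: "\<phi> \<in> ring_hom H H" using \<phi>' by (simp add: ring_iso_def)
  have const: "\<phi> (cls (const a)) = cls (const a)" for a using \<phi>' by blast
  have mult: "\<phi> (cls (p * q)) = cls (subst (act g) (p * q))"
    if "p \<in> F" "q \<in> F" "\<phi> (cls p) = cls (subst (act g) p)" "\<phi> (cls q) = cls (subst (act g) q)" for p q
    unfolding subst_mult cls_mult[OF that(1,2)] cls_mult[OF act_F[OF that(1)] act_F[OF that(2)]] that(3,4)[symmetric]
    by (rule ring_hom_mult[OF hom]) (intro cls_F that)+
  have add: "\<phi> (cls (p + q)) = cls (subst (act g) (p + q))"
    if "p \<in> F" "q \<in> F" "\<phi> (cls p) = cls (subst (act g) p)" "\<phi> (cls q) = cls (subst (act g) q)" for p q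
    unfolding subst_add cls_add[OF that(1,2)] cls_add[OF act_F[OF that(1)] act_F[OF that(2)]] that(3,4)[symmetric]
    by (rule ring_hom_add[OF hom]) (intro cls_F that)+
  have letter: "\<phi> (cls (gen l)) = cls (subst (act g) (gen l))" if "l \<in> letters W" for l
  proof -
    consider v where "l = Vec v" | f where "l = Cov f" "clinear_functional f" | w where "l = Grp w" "w \<in> W"
      using \<open>l \<in> letters W\<close> unfolding letters_def by blast
    then show ?thesis
    proof cases
      case (2 f)
      obtain u where "f = cform u" using clf_E[OF 2(2)] .
      then show ?thesis using \<phi>' by (simp add: 2 subst_gen act_def[OF W R])
    qed (use \<phi>' in \<open>auto simp: subst_gen act_def[OF W R]\<close>)
  qed
  have word: "prod_list (map gen u) \<in> F \<and> \<phi> (cls (prod_list (map gen u))) = cls (subst (act g) (prod_list (map gen u)))"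
    if "set u \<subseteq> letters W" for u
    using that
  proof (induction u)
    case Nil
    then show ?case using const[of 1] by (simp add: subst_1 fc_1)
  next
    case (Cons l u)
    then show ?case using mult[of "gen l" "prod_list (map gen u)"] letter[of l] by (auto intro: fc)
  qed
  have sum: "sum f A \<in> F \<and> \<phi> (cls (sum f A)) = cls (subst (act g) (sum f A))"
    if "\<And>i. i \<in> A \<Longrightarrow> f i \<in> F \<and> \<phi> (cls (f i)) = cls (subst (act g) (f i))" for f :: "'n letter list \<Rightarrow> 'n free" and A
    using that
  proof (induction A rule: infinite_finite_induct)
    case (insert i A)
    then show ?case using add[of "f i" "sum f A"] by (auto intro: fc)
  qed (use const[of 0] in \<open>auto simp: subst_0 fc_0\<close>)
  have monomial: "const a * prod_list (map gen u) \<in> F \<and>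
     \<phi> (cls (const a * prod_list (map gen u))) = cls (subst (act g) (const a * prod_list (map gen u)))"
    if "set u \<subseteq> letters W" for a u
    using word[OF that] mult[OF fc_const[of a], of "prod_list (map gen u)"] const[of a]
    by (auto simp: subst_const intro: fc)
  have e: "p = subst gen p" by (rule subst_id[symmetric, OF _ p]) simp
  have "\<phi> (cls (subst gen p)) = cls (subst (act g) (subst gen p))"
    unfolding subst_def[of gen] by (rule conjunct2[OF sum], rule monomial) (use p in \<open>auto simp: free_carrier\<close>)
  then show ?thesis by (simp only: e[symmetric])
qed

text \<open>Invariance under all automorphisms can be tested on representatives because each matrix of determinant one does
induce an automorphism (\<open>sl2_exists\<close>).\<close>

lemma sl2_invariants_eq: "sl2_invariants W \<alpha> \<alpha>v t c = cls ` angular"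
proof (intro equalityI subsetI)
  fix h assume "h \<in> cls ` angular"
  then obtain p where p: "p \<in> angular" "h = cls p" by blast
  have "\<phi> h = h" if "det g = 1" "sl2_automorphism W \<alpha> \<alpha>v t c g \<phi>" for g \<phi>
    using sl2_automorphism_cls[OF that(2) angular_F[OF p(1)]] act_angular[OF that(1) p(1)]
      cls_eqv[OF act_F[OF angular_F] angular_F, OF p(1) p(1)] p(2) by simp
  then show "h \<in> sl2_invariants W \<alpha> \<alpha>v t c"
    using cls_F[OF angular_F[OF p(1)]] p(2) by (auto simp: sl2_invariants_def)
next
  fix h assume h: "h \<in> sl2_invariants W \<alpha> \<alpha>v t c"
  then obtain p where p: "p \<in> F" "h = cls p" using cls_surj[of h] unfolding sl2_invariants_def by blast
  have "subst (act g) p \<approxeq> p" if g: "det g = 1" for g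
  proof -
    obtain \<phi> where \<phi>: "sl2_automorphism W \<alpha> \<alpha>v t c g \<phi>" using sl2_exists[OF W R g] by blast
    then have "\<phi> h = h" using h g by (auto simp: sl2_invariants_def)
    then show ?thesis
      using sl2_automorphism_cls[OF \<phi> p(1)] cls_eqv[OF act_F[OF p(1)] p(1)] p(2) by simp
  qed
  then show "h \<in> cls ` angular" using invariant_iff_angular[OF p(1)] p(2) by blast
qed

lemma momentum_linear:
  "momentum (u + u') v \<approxeq> momentum u v + momentum u' v"
  "momentum (a *s u) v \<approxeq> const a * momentum u v"
proof -
  let ?y = "\<lambda>u. gen (Vec u) :: 'n free" and ?x = "\<lambda>u. gen (Cov (cform u)) :: 'n free"
  have "momentum (u + u') v - (momentum u v + momentum u' v) =
     (?x (u + u') - (?x u + ?x u')) * ?y v - ?x v * (?y (u + u') - (?y u + ?y u'))"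
    by (simp add: momentum_def algebra_simps)
  also have "\<dots> \<in> I" by (intro I_diff I_l I_r rels letter_F)
  finally show "momentum (u + u') v \<approxeq> momentum u v + momentum u' v" by (simp only: eqv_def)
  have "momentum (a *s u) v - const a * momentum u v =
     (?x (a *s u) - const a * ?x u) * ?y v - ?x v * (?y (a *s u) - const a * ?y u)"
    by (simp add: momentum_def free_algebra_simps)
  also have "\<dots> \<in> I" by (intro I_diff I_l I_r rels letter_F)
  finally show "momentum (a *s u) v \<approxeq> const a * momentum u v" by (simp only: eqv_def)
qed

lemma momentum_swap: "momentum u v = - momentum v u"
  by (simp add: momentum_def)

lemma orthonormal_expansion:
  fixes y :: "'n \<Rightarrow> real^'n" and u :: "complex^'n"
  assumes y: "\<And>i j. y i \<bullet> y j = (if i = j then 1 else 0)"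
  shows "u = (\<Sum>j\<in>UNIV. cform u (cvec (y j)) *s cvec (y j))"
proof -
  let ?A = "(\<chi> i k. y i $ k) :: real^'n^'n"
  have "?A ** transpose ?A = mat 1"
    using y by (simp add: matrix_matrix_mult_def transpose_def mat_def inner_vec_def vec_eq_iff)
  then have "transpose ?A ** ?A = mat 1" using matrix_left_right_inverse by blast
  then have col: "(\<Sum>j\<in>UNIV. y j $ l * y j $ k) = (if l = k then 1 else 0)" for l k
    by (simp add: matrix_matrix_mult_def transpose_def mat_def vec_eq_iff)
  have "(\<Sum>j\<in>UNIV. cform u (cvec (y j)) *s cvec (y j)) $ k = u $ k" for k
  proof -
    have "(\<Sum>j\<in>UNIV. cform u (cvec (y j)) *s cvec (y j)) $ k =
        (\<Sum>j\<in>UNIV. \<Sum>l\<in>UNIV. u $ l * of_real (y j $ l * y j $ k))"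
      by (simp add: cform_def cvec_def sum_distrib_right mult.assoc)
    also have "\<dots> = (\<Sum>l\<in>UNIV. u $ l * of_real (\<Sum>j\<in>UNIV. y j $ l * y j $ k))"
      by (subst sum.swap) (simp add: sum_distrib_left)
    also have "\<dots> = u $ k" by (simp add: col if_distrib cong: if_cong)
    finally show ?thesis .
  qed
  then show ?thesis by (simp add: vec_eq_iff)
qed

text \<open>The hypotheses on \<open>x\<close> and \<open>y\<close> force \<open>x i\<close> to be the functional \<open>(y i)\<^sup>*\<close>, and by bilinearity the momenta of the basis
generate all momenta.\<close>

lemma angular_momentum_algebra_eq:
  fixes y :: "'n \<Rightarrow> real^'n" and x :: "'n \<Rightarrow> complex^'n \<Rightarrow> complex"
  assumes y: "\<And>i j. y i \<bullet> y j = (if i = j then 1 else 0)"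
    and x: "\<And>i. clinear_functional (x i)" "\<And>i j. x i (cvec (y j)) = (if i = j then 1 else 0)"
  shows "dunkl_angular_momentum_algebra W \<alpha> \<alpha>v t c y x = cls ` angular"
proof -
  have xy: "x i = cform (cvec (y i))" for i
  proof -
    obtain w where w: "x i = cform w" using clf_E[OF x(1)] .
    have "cform w (cvec (y j)) *s cvec (y j) = (if i = j then cvec (y j) else 0)" for j
      using x(2)[of i j] by (simp add: w)
    then have "w = cvec (y i)" using orthonormal_expansion[OF y, of w] by simp
    then show ?thesis using w by simp
  qed
  let ?m = "\<lambda>i j. momentum (cvec (y i)) (cvec (y j))"
  let ?G = "range (\<lambda>a. cls (const a)) \<union> {cls (?m i j) | i j. True} \<union> (\<lambda>w. cls (gen (Grp w))) ` W"
  have A: "dunkl_angular_momentum_algebra W \<alpha> \<alpha>v t c y x = generate_ring H ?G"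
    unfolding dunkl_angular_momentum_algebra_def xy momentum_def ..
  have "X \<in> cls ` angular" if "X \<in> generate_ring H ?G" for X
    using that
  proof (induction rule: generate_ring.induct)
    case one
    have "1 \<in> angular" using angular.const[of 1] by simp
    then show ?case unfolding cls_1[symmetric] by (rule imageI)
  next
    case (incl h)
    then consider a where "h = cls (const a)" | i j where "h = cls (?m i j)"
      | w where "h = cls (gen (Grp w))" "w \<in> W" by blast
    then show ?case by cases (auto intro!: imageI intro: angular.const angular.momentum angular.grp)
  next
    case (a_inv h)
    then obtain p where p: "p \<in> angular" "h = cls p" by blast
    show ?case unfolding p(2) cls_uminus[OF angular_F[OF p(1)], symmetric] by (intro imageI angular_uminus p)
  next
    case (eng_add h1 h2)
    then obtain p q where p: "p \<in> angular" "h1 = cls p" and q: "q \<in> angular" "h2 = cls q" by blast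
    show ?case unfolding p(2) q(2) cls_add[OF angular_F[OF p(1)] angular_F[OF q(1)], symmetric] by (intro imageI angular.add p q)
  next
    case (eng_mult h1 h2)
    then obtain p q where p: "p \<in> angular" "h1 = cls p" and q: "q \<in> angular" "h2 = cls q" by blast
    show ?case unfolding p(2) q(2) cls_mult[OF angular_F[OF p(1)] angular_F[OF q(1)], symmetric] by (intro imageI angular.mult p q)
  qed
  moreover have "cls p \<in> generate_ring H ?G" if "p \<in> angular" for p
  proof -
    let ?B = "{p \<in> F. cls p \<in> generate_ring H ?G}"
    have const: "const a \<in> ?B" for a by (auto intro: generate_ring.incl fc_const)
    have add: "p + q \<in> ?B" if "p \<in> ?B" "q \<in> ?B" for p q
      using that by (auto simp: cls_add intro: generate_ring.eng_add fc)
    have mult: "p * q \<in> ?B" if "p \<in> ?B" "q \<in> ?B" for p q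
      using that by (auto simp: cls_mult intro: generate_ring.eng_mult fc)
    have eqv: "p \<in> ?B" if "p \<in> F" "p \<approxeq> q" "q \<in> ?B" for p q
      using that cls_eqv[of p q] by auto
    have uminus: "- p \<in> ?B" if "p \<in> ?B" for p
      using mult[OF const[of "- 1"] that] by simp
    have zero: "0 \<in> ?B" using const[of 0] by simp
    have expand: "momentum u v \<in> ?B" if gens: "\<And>j. momentum (cvec (y j)) v \<in> ?B" for u v
    proof -
      have "momentum (\<Sum>j\<in>A. a j *s cvec (y j)) v \<in> ?B" for A a
      proof (induction A rule: infinite_finite_induct)
        case (insert j A)
        then have m: "momentum (a j *s cvec (y j)) v + momentum (\<Sum>j\<in>A. a j *s cvec (y j)) v \<in> ?B"
          by (intro add eqv[OF momentum_F momentum_linear(2)] mult const gens)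
        have e: "(\<Sum>j\<in>insert j A. a j *s cvec (y j)) = a j *s cvec (y j) + (\<Sum>j\<in>A. a j *s cvec (y j))"
          using insert by simp
        show ?case unfolding e by (rule eqv[OF momentum_F momentum_linear(1) m])
      next
        case (infinite A)
        then show ?case using eqv[OF momentum_F momentum_linear(2)[of 0 0 v]] zero by simp
      next
        case empty
        then show ?case using eqv[OF momentum_F momentum_linear(2)[of 0 0 v]] zero by simp
      qed
      then show ?thesis by (subst orthonormal_expansion[OF y, of u])
    qed
    have "?m i j \<in> ?B" for i j by (auto intro: generate_ring.incl)
    then have "momentum u (cvec (y j)) \<in> ?B" for u j by (rule expand)
    then have "momentum (cvec (y j)) u \<in> ?B" for u j
      by (subst momentum_swap) (rule uminus)
    then have mom: "momentum u v \<in> ?B" for u v by (rule expand)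
    from that have "p \<in> ?B"
    proof (induction rule: angular.induct)
      case (ideal p)
      then show ?case using eqv[OF I_F _ zero, of p] by (simp only: eqv_0)
    next
      case (grp w)
      then show ?case by (auto intro: generate_ring.incl letter_F)
    qed (intro const mom add mult; assumption)+
    then show ?thesis by simp
  qed
  ultimately show ?thesis unfolding A by blast
qed

end

theorem theorem4p9:
  fixes W :: "(real^'n \<Rightarrow> real^'n) set"
    and t :: complex
    and c :: "(real^'n \<Rightarrow> real^'n) \<Rightarrow> complex"
    and \<alpha> :: "(real^'n \<Rightarrow> real^'n) \<Rightarrow> complex^'n \<Rightarrow> complex"
    and \<alpha>v :: "(real^'n \<Rightarrow> real^'n) \<Rightarrow> complex^'n"
    and y :: "'n \<Rightarrow> real^'n"
    and x :: "'n \<Rightarrow> complex^'n \<Rightarrow> complex"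
  assumes "finite_reflection_group W"
    and "irreducible_action W"
    and "conj_invariant W c"
    and "root_data W \<alpha> \<alpha>v"
    and "\<And>i j. y i \<bullet> y j = (if i = j then 1 else 0)"
    and "\<And>i. clinear_functional (x i)"
    and "\<And>i j. x i (cvec (y j)) = (if i = j then 1 else 0)"
  shows "dunkl_angular_momentum_algebra W \<alpha> \<alpha>v t c y x = sl2_invariants W \<alpha> \<alpha>v t c"
proof -
  interpret cherednik W \<alpha> \<alpha>v t c by unfold_locales (rule assms)+
  show ?thesis
    using angular_momentum_algebra_eq[OF assms(5-7)] sl2_invariants_eq by simp
qed

end
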